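(* For any $p>1$, the manifold $\mathrm{int}(X_p)$ is symplectomorphic to the interior of a compact set in $\mathbb{C}^2$ whose boundary has inner Minkowski dimension $\max(2+2/p,\,3)$.
   Context: $\mathbb{C}^2\equiv\mathbb{R}^4$ carries the standard symplectic form. For $p>1$, $X_p=\{(z,w)\in\mathbb{C}^2 : \pi|w|^2\le (1+\pi|z|^2)^{-p}\}$, and $\mathrm{int}$ denotes interior in $\mathbb{C}^2$. For a bounded open set $U\subset\mathbb{R}^4$ let $V_d(U)$ be the volume of $\{x\in U:\mathrm{dist}(x,\partial U)<d\}$. The inner Minkowski dimension of $\partial U$ (with respect to $U$) is $$\dim_M(\partial U)=4-\liminf_{d\to 0}\frac{\ln V_d(U)}{\ln d}.$$ For the boundary of a compact set it is computed with $U$ the interior of that set. *)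

theory Defs
  imports "HOL-Analysis.Analysis"
begin

type_synonym complex2 = "complex \<times> complex"

(* C^k-regularity on an open set S: k-fold iterated directional derivatives exist as Frechet
   derivatives at every point of S, and those of order k are continuous. *)
primrec Ck_on :: "nat \<Rightarrow> 'a::euclidean_space set \<Rightarrow> ('a \<Rightarrow> 'b::euclidean_space) \<Rightarrow> bool" where
  "Ck_on 0 S f \<longleftrightarrow> continuous_on S f"
| "Ck_on (Suc k) S f \<longleftrightarrow>
     (\<forall>x\<in>S. f differentiable (at x)) \<and>
     (\<forall>v. Ck_on k S (\<lambda>x. frechet_derivative f (at x) v))"

definition smooth_on :: "'a::euclidean_space set \<Rightarrow> ('a \<Rightarrow> 'b::euclidean_space) \<Rightarrow> bool" where
  "smooth_on S f \<longleftrightarrow> (\<forall>k. Ck_on k S f)"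

(* The form dx1 \<and> dy1 + dx2 \<and> dy2, where z = x1 + i y1 and w = x2 + i y2. *)
definition omega_std :: "complex2 \<Rightarrow> complex2 \<Rightarrow> real" where
  "omega_std u v =
     (Re (fst u) * Im (fst v) - Im (fst u) * Re (fst v)) +
     (Re (snd u) * Im (snd v) - Im (snd u) * Re (snd v))"

definition symplectomorphism :: "complex2 set \<Rightarrow> complex2 set \<Rightarrow> (complex2 \<Rightarrow> complex2) \<Rightarrow> bool" where
  "symplectomorphism U V \<phi> \<longleftrightarrow>
     open U \<and> open V \<and> bij_betw \<phi> U V \<and>
     smooth_on U \<phi> \<and> smooth_on V (inv_into U \<phi>) \<and>
     (\<forall>x\<in>U. \<forall>u v. omega_std (frechet_derivative \<phi> (at x) u) (frechet_derivative \<phi> (at x) v)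
                    = omega_std u v)"

definition symplectomorphic :: "complex2 set \<Rightarrow> complex2 set \<Rightarrow> bool" where
  "symplectomorphic U V \<longleftrightarrow> (\<exists>\<phi>. symplectomorphism U V \<phi>)"

definition X :: "real \<Rightarrow> complex2 set" where
  "X p = {(z, w). pi * (cmod w)\<^sup>2 \<le> (1 + pi * (cmod z)\<^sup>2) powr (- p)}"

definition inner_collar_volume :: "complex2 set \<Rightarrow> real \<Rightarrow> real" where
  "inner_collar_volume U d = measure lborel {x \<in> U. infdist x (frontier U) < d}"

(* Meaningful for nonempty bounded open U, where the collar volume is positive and finite for
   every d > 0. The lower limit is taken in the extended reals. *)
definition inner_minkowski_dim :: "complex2 set \<Rightarrow> ereal" where
  "inner_minkowski_dim U =
     4 - Liminf (at_right 0) (\<lambda>d. ereal (ln (inner_collar_volume U d) / ln d))"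

definition boundary_inner_minkowski_dim :: "complex2 set \<Rightarrow> ereal" where
  "boundary_inner_minkowski_dim K = inner_minkowski_dim (interior K)"

end

theory Submission
  imports Defs "HOL-Real_Asymp.Real_Asymp"
begin

text \<open>
  Write \<open>z = u + i v\<close> and let \<open>r(z) = \<pi>\<^sup>-\<^sup>1\<^sup>/\<^sup>2 (1 + \<pi> |z|\<^sup>2)\<^sup>-\<^sup>p\<^sup>/\<^sup>2\<close> be the radius of the fibre over \<open>z\<close>.
  The area-preserving map \<open>(u, v) \<mapsto> (x, y) = (u / g'(v), g(v))\<close> with \<open>g'(v) = (1 + v\<^sup>2)\<^sup>-\<^sup>\<kappa>\<close>, \<open>\<kappa> > 1/2\<close>, squeezes the
  plane into a strip of bounded width, and for \<open>\<kappa>\<close> close to \<open>1/2\<close> the fibres over \<open>x\<close> have radius at most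
  \<open>\<rho>(x) = (1 + x\<^sup>2)\<^sup>-\<^sup>\<kappa>\<^sup>/\<^sup>2\<close>. The strip is wound around an annulus, \<open>x\<close> becoming the polar angle, while the fibre
  over \<open>x\<close> is translated to the point \<open>c(x)\<close> of a bounded spiral whose successive passes are far enough
  apart to keep the translated fibres disjoint; shearing \<open>y\<close> by a term linear in \<open>w\<close> keeps the translation symplectic. The result is an
  injective symplectic map with bounded image.

  It is Lipschitz along the fibres, and conversely a point at distance more than a constant times \<open>d\<close>
  from the boundary of its fibre has a full \<open>d\<close>-ball around its image, because \<open>r\<close> is Lipschitz in \<open>(x, y)\<close>.
  As volume is preserved, the collar volume is therefore comparable to the volume of the points of the
  original domain within \<open>d\<close> of the boundary of their fibre. Up to constants, the fibres of radius less
  than \<open>d\<close> contribute \<open>d\<^sup>2\<^sup>-\<^sup>2\<^sup>/\<^sup>p\<close> and the others at most \<open>d\<^sup>\<sigma>\<close> for each \<open>\<sigma> < min 1 (2 - 2/p)\<close>, while the collar of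
  any bounded open set has volume at least of order \<open>d\<close>.
\<close>

section \<open>Smooth maps\<close>

lemma Ck_on_has_derivative:
  "Ck_on (Suc k) S f \<Longrightarrow> x \<in> S \<Longrightarrow> (f has_derivative frechet_derivative f (at x)) (at x)"
  by (simp add: frechet_derivative_works)

lemma Ck_on_frechet: "Ck_on (Suc k) S f \<Longrightarrow> Ck_on k S (\<lambda>x. frechet_derivative f (at x) v)"
  by simp

text \<open>Openness of \<open>S\<close> makes the derivative at a point of \<open>S\<close> depend
  only on the values in \<open>S\<close>, so agreement on \<open>S\<close> passes to all iterated
  derivatives.\<close>

lemma Ck_on_cong:
  assumes "open S" "\<And>x. x \<in> S \<Longrightarrow> f x = g x" "Ck_on k S f"
  shows "Ck_on k S g"
  using assms(2,3)
proof (induction k arbitrary: f g)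
  case 0
  then show ?case by (metis Ck_on.simps(1) continuous_on_cong)
next
  case (Suc k)
  have d: "(g has_derivative frechet_derivative f (at x)) (at x)" if "x \<in> S" for x
    using Ck_on_has_derivative[OF Suc.prems(2) that]
    by (rule has_derivative_transform_within_open[OF _ assms(1) that]) (use Suc.prems(1) in auto)
  then have "frechet_derivative g (at x) = frechet_derivative f (at x)" if "x \<in> S" for x
    using that by (metis frechet_derivative_at)
  then have "Ck_on k S (\<lambda>x. frechet_derivative g (at x) v)" for v
    by (intro Suc.IH[OF _ Ck_on_frechet[OF Suc.prems(2), of v]]) simp
  then show ?case using d by (auto simp: differentiable_def)
qed

text \<open>Derivatives are unique, so an explicit formula \<open>F\<close> may stand in for the
  choice operator \<open>frechet_derivative\<close>. Most closure properties below go through this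
  rule.\<close>

lemma Ck_on_SucI:
  assumes "open S" "\<And>x. x \<in> S \<Longrightarrow> (f has_derivative F x) (at x)" "\<And>v. Ck_on k S (\<lambda>x. F x v)"
  shows "Ck_on (Suc k) S f"
proof -
  have "F x = frechet_derivative f (at x)" if "x \<in> S" for x
    using assms(2)[OF that] by (metis frechet_derivative_at)
  then have "Ck_on k S (\<lambda>x. frechet_derivative f (at x) v)" for v
    by (intro Ck_on_cong[OF assms(1) _ assms(3)[of v]]) simp
  then show ?thesis using assms(2) by (auto simp: differentiable_def)
qed

lemma Ck_on_Suc_imp: "Ck_on (Suc k) S f \<Longrightarrow> Ck_on k S f"
proof (induction k arbitrary: f)
  case 0
  then show ?case
    by (simp add: differentiable_imp_continuous_on differentiable_at_imp_differentiable_on)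
next
  case (Suc k)
  then show ?case by (metis Ck_on.simps(2))
qed

lemma Ck_on_subset: "Ck_on k S f \<Longrightarrow> T \<subseteq> S \<Longrightarrow> Ck_on k T f"
  by (induction k arbitrary: f) (auto intro: continuous_on_subset)

lemma Ck_on_const: "open S \<Longrightarrow> Ck_on k S (\<lambda>x. c)"
proof (induction k arbitrary: c)
  case (Suc k)
  show ?case by (rule Ck_on_SucI[where F="\<lambda>x v. 0"]) (use Suc in auto)
qed simp

lemma Ck_on_add:
  assumes "open S" shows "Ck_on k S f \<Longrightarrow> Ck_on k S g \<Longrightarrow> Ck_on k S (\<lambda>x. f x + g x)"
proof (induction k arbitrary: f g)
  case (Suc k)
  show ?case
    by (rule Ck_on_SucI[OF assms
          has_derivative_add[OF Ck_on_has_derivative[OF Suc.prems(1)] Ck_on_has_derivative[OF Suc.prems(2)]]])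
      (use Suc in auto)
qed (auto intro: continuous_intros)

lemma Ck_on_bounded_linear:
  assumes "open S" "bounded_linear L" shows "Ck_on k S f \<Longrightarrow> Ck_on k S (\<lambda>x. L (f x))"
proof (induction k arbitrary: f)
  case 0
  then show ?case using bounded_linear.continuous_on[OF assms(2)] by auto
next
  case (Suc k)
  show ?case
    by (rule Ck_on_SucI[OF assms(1) bounded_linear.has_derivative[OF assms(2)
          Ck_on_has_derivative[OF Suc.prems(1)]]])
      (use Suc in auto)
qed

lemma Ck_on_sum:
  assumes "open S" "finite A" "\<And>i. i \<in> A \<Longrightarrow> Ck_on k S (f i)"
  shows "Ck_on k S (\<lambda>x. \<Sum>i\<in>A. f i x)"
  using assms(2,3) by (induction A) (auto intro: Ck_on_const Ck_on_add assms(1))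

lemma Ck_on_scaleR:
  fixes f :: "'a::euclidean_space \<Rightarrow> real"
  assumes "open S" shows "Ck_on k S f \<Longrightarrow> Ck_on k S g \<Longrightarrow> Ck_on k S (\<lambda>x. f x *\<^sub>R g x)"
proof (induction k arbitrary: f g)
  case (Suc k)
  show ?case
  proof (rule Ck_on_SucI[OF assms
          has_derivative_scaleR[OF Ck_on_has_derivative[OF Suc.prems(1)] Ck_on_has_derivative[OF Suc.prems(2)]]])
    fix v
    show "Ck_on k S (\<lambda>x. f x *\<^sub>R frechet_derivative g (at x) v + frechet_derivative f (at x) v *\<^sub>R g x)"
      using Suc.prems[THEN Ck_on_frechet] Suc.prems[THEN Ck_on_Suc_imp]
      by (intro Ck_on_add Suc.IH assms)
  qed
qed (auto intro: continuous_intros)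

lemma Ck_on_compose:
  fixes f :: "'b::euclidean_space \<Rightarrow> 'c::euclidean_space"
    and g :: "'a::euclidean_space \<Rightarrow> 'b"
  assumes "open S" "open T"
  shows "Ck_on k T f \<Longrightarrow> Ck_on k S g \<Longrightarrow> g ` S \<subseteq> T \<Longrightarrow> Ck_on k S (\<lambda>x. f (g x))"
proof (induction k arbitrary: f)
  case 0
  then show ?case by (auto intro: continuous_on_compose2)
next
  case (Suc k)
  note g = Ck_on_has_derivative[OF Suc.prems(2)]
  have f: "(f has_derivative frechet_derivative f (at (g x))) (at (g x))" if "x \<in> S" for x
    using Ck_on_has_derivative[OF Suc.prems(1)] that Suc.prems(3) by blast
  show ?case
  proof (rule Ck_on_SucI[OF assms(1)])
    fix x assume x: "x \<in> S"
    have lin: "linear (frechet_derivative f (at (g x)))"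
      using f[OF x] has_derivative_linear by blast
    have "((\<lambda>x. f (g x)) has_derivative
        (\<lambda>v. frechet_derivative f (at (g x)) (frechet_derivative g (at x) v))) (at x)"
      using has_derivative_compose[OF g[OF x] f[OF x]] .
    \<comment> \<open>In the chain rule the direction in which \<open>f\<close> is differentiated
      moves with \<open>x\<close>, while the induction hypothesis covers fixed directions only.
      Expanding in \<open>Basis\<close> leaves derivatives along fixed \<open>b\<close> with scalar
      coefficients.\<close>
    also have "(\<lambda>v. frechet_derivative f (at (g x)) (frechet_derivative g (at x) v)) =
       (\<lambda>v. \<Sum>b\<in>Basis. (frechet_derivative g (at x) v \<bullet> b) *\<^sub>R frechet_derivative f (at (g x)) b)"
      by (rule ext, subst euclidean_representation[symmetric], subst linear_sum[OF lin])
        (simp add: linear_cmul[OF lin] inner_sum_left_Basis)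
    finally show "((\<lambda>x. f (g x)) has_derivative
       (\<lambda>v. \<Sum>b\<in>Basis. (frechet_derivative g (at x) v \<bullet> b) *\<^sub>R frechet_derivative f (at (g x)) b)) (at x)" .
  next
    fix v
    have "Ck_on k S (\<lambda>x. frechet_derivative f (at (g x)) b)" for b
      by (intro Suc.IH Ck_on_frechet Suc.prems Ck_on_Suc_imp)
    then show "Ck_on k S (\<lambda>x. \<Sum>b\<in>Basis. (frechet_derivative g (at x) v \<bullet> b) *\<^sub>R frechet_derivative f (at (g x)) b)"
      by (intro Ck_on_sum Ck_on_scaleR Ck_on_bounded_linear[where L="\<lambda>y. y \<bullet> c" for c]
          bounded_linear_inner_left Ck_on_frechet Suc.prems assms) auto
  qed
qed

lemma smooth_on_imp_has_derivative:
  "smooth_on S f \<Longrightarrow> x \<in> S \<Longrightarrow> (f has_derivative frechet_derivative f (at x)) (at x)"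
  unfolding smooth_on_def using Ck_on_has_derivative by blast

lemma smooth_on_imp_continuous_on: "smooth_on S f \<Longrightarrow> continuous_on S f"
  unfolding smooth_on_def using Ck_on.simps(1) by blast

lemma smooth_on_subset: "smooth_on S f \<Longrightarrow> T \<subseteq> S \<Longrightarrow> smooth_on T f"
  unfolding smooth_on_def using Ck_on_subset by blast

lemma smooth_on_const: "open S \<Longrightarrow> smooth_on S (\<lambda>x. c)"
  unfolding smooth_on_def using Ck_on_const by blast

lemma smooth_on_add: "open S \<Longrightarrow> smooth_on S f \<Longrightarrow> smooth_on S g \<Longrightarrow> smooth_on S (\<lambda>x. f x + g x)"
  unfolding smooth_on_def using Ck_on_add by blast

lemma smooth_on_scaleR:
  fixes f :: "'a::euclidean_space \<Rightarrow> real"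
  shows "open S \<Longrightarrow> smooth_on S f \<Longrightarrow> smooth_on S g \<Longrightarrow> smooth_on S (\<lambda>x. f x *\<^sub>R g x)"
  unfolding smooth_on_def using Ck_on_scaleR by blast

lemma smooth_on_mult:
  fixes f :: "'a::euclidean_space \<Rightarrow> real"
  shows "open S \<Longrightarrow> smooth_on S f \<Longrightarrow> smooth_on S g \<Longrightarrow> smooth_on S (\<lambda>x. f x * g x)"
  using smooth_on_scaleR[of S f g] by simp

lemma smooth_on_bounded_linear:
  "open S \<Longrightarrow> bounded_linear L \<Longrightarrow> smooth_on S f \<Longrightarrow> smooth_on S (\<lambda>x. L (f x))"
  unfolding smooth_on_def using Ck_on_bounded_linear by blast

lemma smooth_on_ident: "open S \<Longrightarrow> smooth_on S (\<lambda>x. x)"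
  unfolding smooth_on_def
proof
  fix k assume S: "open S"
  show "Ck_on k S (\<lambda>x. x)"
    by (cases k) (auto intro!: Ck_on_SucI[where F="\<lambda>x v. v"] S Ck_on_const simp del: Ck_on.simps(2))
qed

lemma smooth_on_linear: "open S \<Longrightarrow> bounded_linear L \<Longrightarrow> smooth_on S L"
  using smooth_on_bounded_linear[OF _ _ smooth_on_ident] .

lemma smooth_on_diff:
  assumes "open S" "smooth_on S f" "smooth_on S g" shows "smooth_on S (\<lambda>x. f x - g x)"
  using smooth_on_add[OF assms(1,2) smooth_on_bounded_linear[OF assms(1) _ assms(3), of uminus]]
  by (simp add: bounded_linear_minus[OF bounded_linear_ident])

lemma smooth_on_compose:
  "open S \<Longrightarrow> open T \<Longrightarrow> smooth_on T f \<Longrightarrow> smooth_on S g \<Longrightarrow> g ` S \<subseteq> T \<Longrightarrow> smooth_on S (\<lambda>x. f (g x))"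
  unfolding smooth_on_def using Ck_on_compose by blast

lemma smooth_on_compose_UNIV:
  "open S \<Longrightarrow> smooth_on UNIV f \<Longrightarrow> smooth_on S g \<Longrightarrow> smooth_on S (\<lambda>x. f (g x))"
  using smooth_on_compose[of S UNIV f g] by simp

text \<open>Suited to functions known only as antiderivatives, such as \<open>g\<close> and
  \<open>\<Theta>\<close> below: their smoothness is read off from the integrand.\<close>

lemma smooth_on_of_real_derivative:
  fixes f :: "real \<Rightarrow> 'b::euclidean_space"
  assumes "open S" "\<And>x. x \<in> S \<Longrightarrow> (f has_vector_derivative f' x) (at x)" "smooth_on S f'"
  shows "smooth_on S f"
  unfolding smooth_on_def
proof
  fix k
  have "Ck_on (Suc k) S f"
  proof (rule Ck_on_SucI[OF assms(1)])
    show "(f has_derivative (\<lambda>v. v *\<^sub>R f' x)) (at x)" if "x \<in> S" for x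
      using assms(2)[OF that] by (simp add: has_vector_derivative_def)
    show "Ck_on k S (\<lambda>x. v *\<^sub>R f' x)" for v
      using assms(1,3) by (intro Ck_on_scaleR Ck_on_const) (auto simp: smooth_on_def)
  qed
  then show "Ck_on k S f" by (rule Ck_on_Suc_imp)
qed

lemma Ck_on_powr: "Ck_on k {0<..} (\<lambda>t::real. t powr a)"
proof (induction k arbitrary: a)
  case 0
  show ?case by (auto intro!: continuous_intros)
next
  case (Suc k)
  show ?case
  proof (rule Ck_on_SucI)
    show "((\<lambda>t. t powr a) has_derivative (\<lambda>v. (a * v) *\<^sub>R (x powr (a - 1)))) (at x)" if "x \<in> {0<..}" for x
      using that by (auto intro!: derivative_eq_intros simp: powr_diff field_simps)
    show "Ck_on k {0<..} (\<lambda>x. (a * v) *\<^sub>R (x powr (a - 1)))" for v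
      by (intro Ck_on_scaleR Ck_on_const Suc.IH) auto
  qed auto
qed

lemma smooth_on_powr:
  fixes f :: "'a::euclidean_space \<Rightarrow> real"
  assumes "open S" "smooth_on S f" "\<And>x. x \<in> S \<Longrightarrow> f x > 0"
  shows "smooth_on S (\<lambda>x. f x powr a)"
  by (rule smooth_on_compose[OF assms(1) _ _ assms(2), of "{0<..}" "\<lambda>t::real. t powr a"])
    (use assms(3) Ck_on_powr in \<open>auto simp: smooth_on_def\<close>)

text \<open>The phase \<open>a\<close> closes the induction: differentiating \<open>cis\<close>
  advances the phase by a quarter turn.\<close>

lemma Ck_on_cis: "Ck_on k UNIV (\<lambda>t. cis (t + a))"
proof (induction k arbitrary: a)
  case 0
  show ?case by (auto intro!: continuous_intros)
next
  case (Suc k)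
  show ?case
  proof (rule Ck_on_SucI)
    show "((\<lambda>t. cis (t + a)) has_derivative (\<lambda>v. v *\<^sub>R cis (x + (a + pi/2)))) (at x)" for x
    proof -
      have "cis (x + (a + pi/2)) = \<i> * cis (x + a)"
        by (simp add: cis_mult[symmetric] add.assoc[symmetric] )
      then show ?thesis
        by (auto intro!: derivative_eq_intros)
    qed
    show "Ck_on k UNIV (\<lambda>x. v *\<^sub>R cis (x + (a + pi/2)))" for v
      by (intro Ck_on_scaleR Ck_on_const Suc.IH) auto
  qed auto
qed

lemma smooth_on_cis:
  assumes "open S" "smooth_on S f"
  shows "smooth_on S (\<lambda>x. cis (f x))"
  by (rule smooth_on_compose_UNIV[OF assms(1) _ assms(2), of cis])
    (use Ck_on_cis[of _ 0] in \<open>auto simp: smooth_on_def\<close>)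

lemma smooth_on_Pair:
  assumes "open S" "smooth_on S f" "smooth_on S g"
  shows "smooth_on S (\<lambda>x. (f x, g x))"
proof -
  have "smooth_on S (\<lambda>x. (f x, 0) + (0, g x))"
    by (intro smooth_on_add assms(1)
        smooth_on_bounded_linear[OF assms(1) bounded_linear_Pair[OF bounded_linear_ident bounded_linear_zero] assms(2)]
        smooth_on_bounded_linear[OF assms(1) bounded_linear_Pair[OF bounded_linear_zero bounded_linear_ident] assms(3)])
  then show ?thesis by simp
qed

section \<open>Symplectic maps\<close>

definition symplectic_linear :: "(complex2 \<Rightarrow> complex2) \<Rightarrow> bool" where
  "symplectic_linear A \<longleftrightarrow> linear A \<and> (\<forall>u v. omega_std (A u) (A v) = omega_std u v)"

lemma omega_std_bounded_linear_right: "bounded_linear (\<lambda>v. omega_std u v)"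
  unfolding omega_std_def
  by (intro bounded_linear_intros bounded_linear_compose[OF bounded_linear_Re]
      bounded_linear_compose[OF bounded_linear_Im] bounded_linear_fst bounded_linear_snd)

text \<open>The inverse of a symplectic linear map is its adjoint with respect to the form, expressed in
  the standard symplectic basis.\<close>

definition omega_adjoint :: "(complex2 \<Rightarrow> complex2) \<Rightarrow> complex2 \<Rightarrow> complex2" where
  "omega_adjoint A v =
     (Complex (omega_std v (A (\<i>, 0))) (- omega_std v (A (1, 0))),
      Complex (omega_std v (A (0, \<i>))) (- omega_std v (A (0, 1))))"

lemma omega_adjoint_left:
  assumes "symplectic_linear A" shows "omega_adjoint A (A u) = u"
proof -
  have "omega_std (A u) (A v) = omega_std u v" for v
    using assms unfolding symplectic_linear_def by blast
  then show ?thesis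
    unfolding omega_adjoint_def by (simp only:) (simp add: omega_std_def prod_eq_iff)
qed

lemma omega_adjoint_right:
  assumes "symplectic_linear A" shows "A (omega_adjoint A v) = v"
proof -
  have "linear A" using assms by (simp add: symplectic_linear_def)
  moreover have "inj A"
    using omega_adjoint_left[OF assms] by (metis injI)
  ultimately have "surj A" by (rule linear_injective_imp_surjective) simp
  then obtain u where "v = A u" by blast
  then show ?thesis using omega_adjoint_left[OF assms] by simp
qed

lemma Ck_on_Complex:
  assumes "open S" "Ck_on k S f" "Ck_on k S g" shows "Ck_on k S (\<lambda>x. Complex (f x) (g x))"
proof -
  have "Ck_on k S (\<lambda>x. f x *\<^sub>R 1 + g x *\<^sub>R \<i>)"
    by (intro Ck_on_add Ck_on_scaleR Ck_on_const assms)
  moreover have "(\<lambda>x. f x *\<^sub>R 1 + g x *\<^sub>R \<i>) = (\<lambda>x. Complex (f x) (g x))"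
    by (auto simp: complex_eq_iff)
  ultimately show ?thesis by simp
qed

text \<open>The entries of the adjoint are linear in the vectors \<open>F x b\<close>, so inverting
  a symplectic derivative needs no division.\<close>

lemma Ck_on_omega_adjoint:
  assumes S: "open S" and C: "\<And>b. Ck_on k S (\<lambda>x. F x b)"
  shows "Ck_on k S (\<lambda>x. omega_adjoint (F x) v)"
proof -
  have 1: "Ck_on k S (\<lambda>x. omega_std v (F x b))" for b
    by (intro Ck_on_bounded_linear[OF S omega_std_bounded_linear_right] C)
  have 2: "Ck_on k S (\<lambda>x. - omega_std v (F x b))" for b
    by (intro Ck_on_bounded_linear[OF S _ 1] bounded_linear_minus bounded_linear_ident)
  have "Ck_on k S (\<lambda>x. (\<lambda>y. (y, 0)) (Complex (omega_std v (F x (\<i>, 0))) (- omega_std v (F x (1, 0))))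
     + (\<lambda>y. (0, y)) (Complex (omega_std v (F x (0, \<i>))) (- omega_std v (F x (0, 1)))))"
    by (intro Ck_on_add Ck_on_bounded_linear[where L="\<lambda>y::complex. (y, 0::complex)"]
       Ck_on_bounded_linear[where L="\<lambda>y::complex. (0::complex, y)"] Ck_on_Complex 1 2 S bounded_linear_intros)
  then show ?thesis by (simp add: omega_adjoint_def)
qed

text \<open>Invariance of domain makes the image open. The derivative of the inverse is the adjoint
  of the derivative of \<open>\<phi>\<close>, taken at the inverse itself, so each order of
  regularity of the inverse yields the next one.\<close>

lemma symplectomorphism_of_injective:
  fixes \<phi> :: "complex2 \<Rightarrow> complex2"
  assumes U: "open U" and inj: "inj_on \<phi> U" and sm: "smooth_on U \<phi>"
    and sy: "\<And>x. x \<in> U \<Longrightarrow> symplectic_linear (frechet_derivative \<phi> (at x))"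
  shows "symplectomorphism U (\<phi> ` U) \<phi>"
proof -
  let ?\<psi> = "inv_into U \<phi>"
  let ?D = "\<lambda>x. frechet_derivative \<phi> (at x)"
  have cont: "continuous_on U \<phi>" by (rule smooth_on_imp_continuous_on[OF sm])
  have V: "open (\<phi> ` U)" by (rule invariance_of_domain[OF cont U inj])
  have in_U: "?\<psi> y \<in> U" if "y \<in> \<phi> ` U" for y using that by (rule inv_into_into)
  have der: "(?\<psi> has_derivative omega_adjoint (?D (?\<psi> y))) (at y)" if y: "y \<in> \<phi> ` U" for y
  proof (rule has_derivative_inverse_strong_x[where f=\<phi> and S=U])
    show "open U" "?\<psi> y \<in> U" "continuous_on U \<phi>" by (fact U in_U[OF y] cont)+
    show "?\<psi> (\<phi> x) = x" if "x \<in> U" for x using inj that by simp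
    show "(\<phi> has_derivative ?D (?\<psi> y)) (at (?\<psi> y))"
      by (rule smooth_on_imp_has_derivative[OF sm in_U[OF y]])
    show "?D (?\<psi> y) \<circ> omega_adjoint (?D (?\<psi> y)) = id"
      using omega_adjoint_right[OF sy[OF in_U[OF y]]] by auto
    show "\<phi> (?\<psi> y) = y" using y by (rule f_inv_into_f)
  qed
  have "Ck_on k (\<phi> ` U) ?\<psi>" for k
  proof (induction k)
    case 0
    show ?case
      unfolding Ck_on.simps(1) by (rule has_derivative_continuous_on[OF has_derivative_at_withinI[OF der]])
  next
    case (Suc k)
    show ?case
    proof (rule Ck_on_SucI[OF V der])
      fix v
      have "Ck_on k (\<phi> ` U) (\<lambda>y. ?D (?\<psi> y) b)" for b
      proof (rule Ck_on_compose[OF V U Ck_on_frechet Suc.IH])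
        show "Ck_on (Suc k) U \<phi>" using sm by (simp only: smooth_on_def)
        show "?\<psi> ` \<phi> ` U \<subseteq> U" using in_U by blast
      qed
      then show "Ck_on k (\<phi> ` U) (\<lambda>y. omega_adjoint (?D (?\<psi> y)) v)"
        by (rule Ck_on_omega_adjoint[OF V])
    qed
  qed
  then have "smooth_on (\<phi> ` U) ?\<psi>" unfolding smooth_on_def by blast
  then show ?thesis
    using U V inj sm sy unfolding symplectomorphism_def symplectic_linear_def bij_betw_def by blast
qed

lemma symplectic_linear_compose:
  "symplectic_linear A \<Longrightarrow> symplectic_linear B \<Longrightarrow> symplectic_linear (\<lambda>x. A (B x))"
  unfolding symplectic_linear_def using linear_compose[of B A] by (simp add: o_def del: split_paired_All)

section \<open>Symplectic maps preserve volume\<close>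

text \<open>Matching two orthonormal bases gives a linear isometry, and Lebesgue measure is carried
  along because it is determined by boxes. This moves volume questions from \<open>complex2\<close>
  to \<open>real^4\<close>, where matrices and determinants are at hand.\<close>

lemma lborel_isometry_exists:
  assumes "DIM('a::euclidean_space) = DIM('b::euclidean_space)"
  obtains T :: "'a::euclidean_space \<Rightarrow> 'b::euclidean_space" and S :: "'b::euclidean_space \<Rightarrow> 'a::euclidean_space"
    where "linear T" "linear S" "\<And>x. S (T x) = x" "\<And>y. T (S y) = y"
      "\<And>x y. T x \<bullet> T y = x \<bullet> y" "distr lborel borel T = lborel"
proof -
  obtain f where f: "bij_betw f (Basis :: 'a set) (Basis :: 'b set)"
    using assms by (metis finite_Basis finite_same_card_bij)
  define T where "T x = (\<Sum>b\<in>Basis. (x \<bullet> b) *\<^sub>R f b)" for x :: 'a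
  define S where "S y = (\<Sum>b\<in>Basis. (y \<bullet> f b) *\<^sub>R b)" for y :: 'b
  have fB: "f b \<in> Basis" if "b \<in> Basis" for b using f that by (auto simp: bij_betw_def)
  have fin: "f b \<bullet> f c = (if b = c then 1 else 0)" if "b \<in> Basis" "c \<in> Basis" for b c
    using fB that f by (auto simp: inner_Basis bij_betw_def inj_on_def)
  have Tf: "T x \<bullet> f b = x \<bullet> b" if "b \<in> Basis" for x b
  proof -
    have "T x \<bullet> f b = (\<Sum>c\<in>Basis. (x \<bullet> c) * (f c \<bullet> f b))" by (simp add: T_def inner_sum_left)
    also have "\<dots> = (\<Sum>c\<in>Basis. if c = b then x \<bullet> b else 0)"
      by (intro sum.cong) (auto simp: fin that)
    finally show ?thesis using that by simp
  qed
  have Sb: "S y \<bullet> b = y \<bullet> f b" if "b \<in> Basis" for y b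
    using that by (simp add: S_def)
  have all_f: "(\<forall>c\<in>Basis. P c) \<longleftrightarrow> (\<forall>b\<in>Basis. P (f b))" for P
    using f unfolding bij_betw_def by (metis imageE imageI)
  have lin: "linear T" "linear S"
    by (auto intro!: linearI simp: T_def S_def inner_add_left scaleR_add_left sum.distrib scaleR_sum_right)
  have ST: "S (T x) = x" for x by (rule euclidean_eqI) (simp add: Sb Tf)
  have TS: "T (S y) = y" for y
  proof (rule euclidean_eqI)
    fix c :: 'b assume "c \<in> Basis"
    then obtain b where "b \<in> Basis" "c = f b" using f by (auto simp: bij_betw_def)
    then show "T (S y) \<bullet> c = y \<bullet> c" by (simp add: Tf Sb)
  qed
  have iso: "T x \<bullet> T y = x \<bullet> y" for x y
  proof -
    have "T x \<bullet> T y = (\<Sum>b\<in>Basis. (x \<bullet> b) * (f b \<bullet> T y))" by (simp add: T_def[of x] inner_sum_left)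
    also have "\<dots> = (\<Sum>b\<in>Basis. (x \<bullet> b) * (y \<bullet> b))"
      by (intro sum.cong) (auto simp: Tf inner_commute[of "f _"])
    finally show ?thesis by (simp add: euclidean_inner[of x y])
  qed
  have meas: "T \<in> borel_measurable borel"
    using lin(1) by (simp add: borel_measurable_continuous_onI linear_continuous_on linear_conv_bounded_linear)
  have "lborel = distr lborel borel T"
  proof (rule lborel_eqI)
    fix l u :: 'b assume lu: "\<And>b. b \<in> Basis \<Longrightarrow> l \<bullet> b \<le> u \<bullet> b"
    have "T -` box l u = box (S l) (S u)"
      unfolding box_def vimage_def mem_Collect_eq all_f by (auto simp: Sb Tf)
    then have "emeasure (distr lborel borel T) (box l u) = emeasure lborel (box (S l) (S u))"
      using meas by (simp add: emeasure_distr)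
    also have "\<dots> = (\<Prod>b\<in>Basis. (S u - S l) \<bullet> b)"
      using lu fB by (intro emeasure_lborel_box) (auto simp: Sb)
    also have "(\<Prod>b\<in>Basis. (S u - S l) \<bullet> b) = (\<Prod>b\<in>Basis. (u - l) \<bullet> f b)"
      by (intro prod.cong) (auto simp: Sb inner_diff_left)
    also have "\<dots> = (\<Prod>b\<in>Basis. (u - l) \<bullet> b)"
      by (rule prod.reindex_bij_betw[OF f])
    finally show "emeasure (distr lborel borel T) (box l u) = (\<Prod>b\<in>Basis. (u - l) \<bullet> b)" .
  qed simp
  then show ?thesis using that[OF lin ST TS iso] by simp
qed

lemma omega_std_inner: "omega_std u v = u \<bullet> (- \<i> * fst v, - \<i> * snd v)"
  by (cases u; cases v) (simp add: omega_std_def inner_complex_def)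

text \<open>With \<open>J\<close> the matrix of the form, invariance reads M^T J M = J. Determinants
  give (det M)^2 = 1 once det J is nonzero, and J^4 = 1 ensures that.\<close>

lemma det_symplectic:
  fixes T :: "complex2 \<Rightarrow> real^4" and S :: "real^4 \<Rightarrow> complex2"
  assumes lin: "linear T" "linear S" and ST: "\<And>x. S (T x) = x" and TS: "\<And>y. T (S y) = y"
    and iso: "\<And>x y. T x \<bullet> T y = x \<bullet> y" and A: "symplectic_linear A"
  shows "\<bar>det (matrix (\<lambda>x. T (A (S x))))\<bar> = 1"
proof -
  define J :: "complex2 \<Rightarrow> complex2" where "J v = (- \<i> * fst v, - \<i> * snd v)" for v
  let ?M = "matrix (\<lambda>x. T (A (S x)))" and ?J = "matrix (\<lambda>x. T (J (S x)))"
  have linA: "linear A" and om: "omega_std (A u) (A v) = omega_std u v" for u v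
    using A unfolding symplectic_linear_def by blast+
  have linJ: "linear J" by (rule linearI) (auto simp: J_def algebra_simps scaleR_conv_of_real)
  have l: "linear (\<lambda>x. T (A (S x)))" "linear (\<lambda>x. T (J (S x)))"
    using linear_compose[OF linear_compose[OF lin(2) linA] lin(1)]
      linear_compose[OF linear_compose[OF lin(2) linJ] lin(1)] by (simp_all add: o_def)
  have M: "?M *v x = T (A (S x))" and J: "?J *v x = T (J (S x))" for x
    using l by (simp_all add: matrix_works linear_matrix_vector_mul_eq)
  have "(transpose ?M ** ?J ** ?M) *v y = ?J *v y" for y
  proof -
    have "x \<bullet> ((transpose ?M ** ?J ** ?M) *v y) = x \<bullet> (?J *v y)" for x
    proof -
      have "x \<bullet> ((transpose ?M ** ?J ** ?M) *v y) = x \<bullet> (transpose ?M *v (?J *v (?M *v y)))"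
        by (simp add: matrix_vector_mul_assoc matrix_mul_assoc)
      also have "\<dots> = (?M *v x) \<bullet> (?J *v (?M *v y))"
        by (simp only: dot_lmul_matrix[symmetric, of x "transpose ?M"] vector_transpose_matrix)
      also have "\<dots> = A (S x) \<bullet> J (A (S y))" by (simp add: M J ST iso)
      also have "\<dots> = S x \<bullet> J (S y)"
        using om[of "S x" "S y"] by (simp add: omega_std_inner J_def)
      also have "\<dots> = x \<bullet> (?J *v y)" using iso[of "S x" "J (S y)"] by (simp add: J TS)
      finally show ?thesis .
    qed
    then show ?thesis using vector_eq_ldot by blast
  qed
  then have "transpose ?M ** ?J ** ?M = ?J" using matrix_eq by blast
  then have "det (transpose ?M ** ?J ** ?M) = det ?J" by simp
  then have "det ?M * det ?J * det ?M = det ?J" by (simp only: det_mul det_transpose)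
  moreover have "det ?J \<noteq> 0"
  proof -
    have "(?J ** ?J) *v x = - x" for x
    proof -
      have "(?J ** ?J) *v x = T (J (J (S x)))"
        by (simp add: matrix_vector_mul_assoc[symmetric] J ST)
      also have "J (J (S x)) = - S x" by (simp add: J_def prod_eq_iff)
      also have "T (- S x) = - x" using linear_neg[OF lin(1)] by (simp add: TS)
      finally show ?thesis .
    qed
    then have "((?J ** ?J) ** (?J ** ?J)) *v x = mat 1 *v x" for x
      by (simp add: matrix_vector_mul_assoc[symmetric, of "?J ** ?J"])
    then have "(?J ** ?J) ** (?J ** ?J) = mat 1" using matrix_eq by blast
    then have "det ((?J ** ?J) ** (?J ** ?J)) = 1" by simp
    then have "det ?J * det ?J * (det ?J * det ?J) = 1" by (simp only: det_mul)
    then show ?thesis by auto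
  qed
  ultimately have "det ?M * det ?M = 1" by (simp add: mult.commute mult.left_commute)
  then show ?thesis by (auto simp: square_eq_1_iff)
qed

text \<open>Change of variables in \<open>real^4\<close>, with a Jacobian of absolute value 1
  throughout.\<close>

lemma emeasure_symplectic_image:
  fixes \<phi> :: "complex2 \<Rightarrow> complex2"
  assumes A: "open A" and inj: "inj_on \<phi> A" and fin: "emeasure lborel A < \<infinity>"
    and der: "\<And>x. x \<in> A \<Longrightarrow> (\<phi> has_derivative \<phi>' x) (at x)"
    and sy: "\<And>x. x \<in> A \<Longrightarrow> symplectic_linear (\<phi>' x)"
  shows "emeasure lborel (\<phi> ` A) = emeasure lborel A"
proof -
  have "DIM(complex2) = DIM(real^4)" by simp
  then obtain T :: "complex2 \<Rightarrow> real^4" and S where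
    lin: "linear T" "linear S" and ST: "\<And>x. S (T x) = x" and TS: "\<And>y. T (S y) = y"
    and iso: "\<And>x y. T x \<bullet> T y = x \<bullet> y" and dist: "distr lborel borel T = lborel"
    by (rule lborel_isometry_exists) (rule that)
  note bl = lin[unfolded linear_conv_bounded_linear]
  have opT: "open (T ` B)" if "open B" for B
  proof -
    have "T ` B = S -` B" by (auto simp: ST) (metis TS imageI)
    then show ?thesis
      using that linear_continuous_on[OF bl(2), of UNIV] by (simp add: open_vimage)
  qed
  have emT: "emeasure lborel (T ` B) = emeasure lborel B" if "open B" for B
  proof -
    have "T \<in> borel_measurable borel"
      by (rule borel_measurable_continuous_onI) (use linear_continuous_on[OF bl(1)] in auto)
    then have "emeasure (distr lborel borel T) (T ` B) = emeasure lborel (T -` T ` B)"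
      using opT[OF that] by (simp add: emeasure_distr)
    also have "T -` T ` B = B" using ST by (auto simp: vimage_def) metis
    finally show ?thesis by (simp add: dist)
  qed
  have op: "open (\<phi> ` A)"
    by (rule invariance_of_domain[OF _ A inj])
      (rule has_derivative_continuous_on[OF has_derivative_at_withinI[OF der]])
  define f where "f x = T (\<phi> (S x))" for x
  define f' where "f' x = (\<lambda>v. T (\<phi>' (S x) (S v)))" for x
  have fin': "T ` A \<in> lmeasurable"
    using opT[OF A] emT[OF A] fin by (auto simp: fmeasurable_def)
  have fA: "f ` T ` A = T ` \<phi> ` A" by (auto simp: f_def ST image_image)
  have "f ` (T ` A) \<in> lmeasurable \<and> measure lebesgue (f ` (T ` A)) = measure lebesgue (T ` A)"
  proof (subst has_measure_differentiable_image)
    show "T ` A \<in> sets lebesgue" using fin' by (simp add: fmeasurableD)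
    show "(f has_derivative f' x) (at x within T ` A)" if "x \<in> T ` A" for x
    proof -
      have "S x \<in> A" using that ST by auto
      have "((\<lambda>x. \<phi> (S x)) has_derivative (\<lambda>v. \<phi>' (S x) (S v))) (at x)"
        by (rule has_derivative_compose[OF bounded_linear_imp_has_derivative[OF bl(2)] der[OF \<open>S x \<in> A\<close>]])
      from bounded_linear.has_derivative[OF bl(1) this] show ?thesis
        unfolding f_def f'_def by (rule has_derivative_at_withinI)
    qed
    show "inj_on f (T ` A)"
      using inj by (auto simp: inj_on_def f_def ST) (metis ST inj_on_def)
    have "((\<lambda>x. 1) has_integral measure lebesgue (T ` A)) (T ` A)"
      using has_integral_measure_lborel lmeasure_integral[OF fin'] fin'
      by (simp add: has_integral_iff integrable_on_const)
    then show "((\<lambda>x. \<bar>det (matrix (f' x))\<bar>) has_integral measure lebesgue (T ` A)) (T ` A)"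
    proof (rule has_integral_eq[rotated])
      fix x assume "x \<in> T ` A"
      then have "S x \<in> A" using ST by auto
      then show "1 = \<bar>det (matrix (f' x))\<bar>"
        unfolding f'_def using det_symplectic[OF lin ST TS iso sy] by metis
    qed
  qed
  then have "emeasure lebesgue (T ` \<phi> ` A) = emeasure lebesgue (T ` A)"
    unfolding fA using fin' by (metis emeasure_eq_measure2)
  then show ?thesis using emT[OF op] emT[OF A] opT[OF op] opT[OF A] by simp
qed

section \<open>Inner collars and the inner Minkowski dimension\<close>

lemma infdist_frontier_le_dist:
  fixes x y :: "'a::euclidean_space"
  assumes "x \<in> U" "y \<notin> U"
  shows "infdist x (frontier U) \<le> dist x y"
proof -
  have "closed_segment x y \<inter> frontier U \<noteq> {}"
    using assms by (intro connected_Int_frontier connected_segment) auto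
  then obtain z where z: "z \<in> closed_segment x y" "z \<in> frontier U" by blast
  have "infdist x (frontier U) \<le> dist x z" by (rule infdist_le[OF z(2)])
  also have "\<dots> \<le> dist x y" using segment_bound(1)[OF z(1)] by (simp add: dist_norm norm_minus_commute)
  finally show ?thesis .
qed

lemma infdist_frontier_ge:
  fixes x :: "'a::euclidean_space"
  assumes "open U" "bounded U" "ball x d \<subseteq> U" "x \<in> U"
  shows "d \<le> infdist x (frontier U)"
proof -
  \<comment> \<open>\<open>infdist\<close> to the empty set is 0, so the bound needs a frontier
    point; a nonempty bounded set has one.\<close>
  have "frontier U \<noteq> {}"
    using assms by (metis frontier_eq_empty not_bounded_UNIV empty_iff)
  moreover have "d \<le> dist x y" if "y \<in> frontier U" for y
    using that assms by (force simp: frontier_def interior_open)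
  ultimately show ?thesis unfolding infdist_def by (auto intro: cINF_greatest)
qed

lemma open_inner_collar:
  fixes U :: "'a::euclidean_space set"
  shows "open U \<Longrightarrow> open {x \<in> U. infdist x (frontier U) < d}"
  unfolding Collect_conj_eq
  by (intro open_Int open_Collect_less continuous_on_infdist continuous_intros) auto

text \<open>Only a translate by the diameter moves all of \<open>U\<close> off itself, and the volume moved off is
  subadditive in the translation length.\<close>

lemma inner_collar_volume_linear_lower_bound:
  assumes U: "open U" "bounded U" "U \<noteq> {}"
  obtains c where "c > 0" "\<And>d. 0 < d \<Longrightarrow> d < 1 \<Longrightarrow> c * d \<le> inner_collar_volume U d"
proof -
  obtain B where B: "B > 0" "\<And>x. x \<in> U \<Longrightarrow> norm x \<le> B"
    using U(2) bounded_pos by blast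
  \<comment> \<open>Exceeds the diameter bound \<open>2 * B\<close>, so translation by
    \<open>T\<close> moves every point of \<open>U\<close> out of \<open>U\<close>.\<close>
  define T where "T = 2 * B + 1"
  define e :: complex2 where "e = (1, 0)"
  have e: "norm e = 1" by (simp add: e_def)
  have exit: "x + T *\<^sub>R e \<notin> U" if "x \<in> U" for x
  proof
    assume "x + T *\<^sub>R e \<in> U"
    then have "norm (x + T *\<^sub>R e) \<le> B" by (rule B(2))
    moreover have "norm (T *\<^sub>R e) \<le> norm (x + T *\<^sub>R e) + norm x"
      by (metis add.commute add_diff_cancel_left' norm_triangle_ineq4)
    ultimately show False using B(2)[OF that] B(1) by (simp add: e T_def)
  qed
  have fm: "S \<in> lmeasurable" "S \<in> sets borel" if "S = U \<or> (\<exists>t. S = {x \<in> U. x + t *\<^sub>R e \<notin> U})" for S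
  proof -
    have op: "open ((\<lambda>x. x + t *\<^sub>R e) -` U)" for t
      by (rule open_vimage[OF U(1)]) (intro continuous_intros)
    have eq: "{x \<in> U. x + t *\<^sub>R e \<notin> U} = U - (\<lambda>x. x + t *\<^sub>R e) -` U" for t by auto
    have bor: "{x \<in> U. x + t *\<^sub>R e \<notin> U} \<in> sets borel" for t
      unfolding eq by (intro sets.Diff borel_open op U(1))
    show borel: "S \<in> sets borel"
      by (rule disjE[OF that]) (use borel_open[OF U(1)] bor in blast)+
    have "bounded S" using that by (elim disjE exE) (auto intro: bounded_subset[OF U(2)])
    then show "S \<in> lmeasurable" by (rule bounded_set_imp_lmeasurable) (use borel in simp)
  qed
  define v where "v = measure lborel U"
  have v: "v > 0"
  proof -
    have "measure lebesgue U \<noteq> 0"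
      using open_not_negligible[OF U(1,3)] fm(1)[of U] negligible_iff_measure0 by blast
    then show ?thesis using U(1) unfolding v_def by (simp add: zero_less_measure_iff)
  qed
  show ?thesis
  proof (rule that[of "v / (T + 1)"])
    show "v / (T + 1) > 0" using v B(1) by (simp add: T_def)
    fix d :: real assume d: "0 < d" "d < 1"
    \<comment> \<open>The least integer strictly above \<open>T / d\<close>: then \<open>N\<close>
      steps of length \<open>t < d\<close> add up to exactly \<open>T\<close>.\<close>
    define N where "N = nat \<lfloor>T / d\<rfloor> + 1"
    define t where "t = T / N"
    have T0: "T > 0" using B(1) by (simp add: T_def)
    have "real N = \<lfloor>T / d\<rfloor> + 1" using T0 d by (simp add: N_def)
    then have N: "T / d < N" "N \<le> T / d + 1" by linarith+
    have t: "0 < t" "t < d" "N * t = T"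
    proof -
      have "0 < T / d" using T0 d by simp
      then have "real N > 0" using N(1) by linarith
      then show "0 < t" "t < d" "N * t = T"
        using N(1) T0 d(1) unfolding t_def by (simp_all add: field_simps)
    qed
    \<comment> \<open>Points thrown out by a single step. The segment to the translate crosses the
      frontier, so they lie in the collar of width \<open>d\<close>.\<close>
    define D where "D = {x \<in> U. x + t *\<^sub>R e \<notin> U}"
    have D: "D \<in> lmeasurable" "D \<in> sets borel" using fm unfolding D_def by blast+
    define P where "P j = (\<lambda>x. x + (real j * t) *\<^sub>R e) -` D" for j
    have P: "P j \<in> lmeasurable" "measure lebesgue (P j) = measure lebesgue D" for j
    proof -
      have "P j = (+) (- (real j * t) *\<^sub>R e) ` D"
        by (force simp: P_def image_iff algebra_simps)
      then show "P j \<in> lmeasurable" "measure lebesgue (P j) = measure lebesgue D"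
        by (simp_all only: measurable_translation[OF D(1)] measure_translation)
    qed
    \<comment> \<open>The step at which the orbit of \<open>x\<close> first leaves \<open>U\<close>
      starts in \<open>D\<close>. Hence \<open>N\<close> translates of \<open>D\<close> cover
      \<open>U\<close>, and \<open>D\<close> has at least the volume of \<open>U\<close> divided by
      \<open>N\<close>.\<close>
    have "U \<subseteq> (\<Union>j<N. P j)"
    proof
      fix x assume x: "x \<in> U"
      let ?Q = "\<lambda>j. x + (real j * t) *\<^sub>R e \<notin> U"
      have "?Q N" using exit[OF x] t(3) by simp
      then obtain k where k: "?Q k" "\<And>i. i < k \<Longrightarrow> \<not> ?Q i" "k \<le> N"
        using exists_least_iff[of ?Q] by (metis linorder_not_less)
      then have "k \<noteq> 0" using x by (metis add.right_neutral mult_zero_left of_nat_0 scaleR_zero_left)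
      then obtain j where j: "k = Suc j" by (metis not0_implies_Suc)
      have "x + (real j * t) *\<^sub>R e \<in> D"
        using k j by (auto simp: D_def algebra_simps)
      then show "x \<in> (\<Union>j<N. P j)" using j k(3) by (auto simp: P_def intro!: bexI[of _ j])
    qed
    then have "measure lebesgue U \<le> measure lebesgue (\<Union>j<N. P j)"
      using fm(1)[of U] P(1) by (intro measure_mono_fmeasurable fmeasurable.finite_UN) (auto simp: fmeasurableD)
    also have "\<dots> \<le> (\<Sum>j<N. measure lebesgue (P j))"
      using P(1) by (intro measure_UNION_le) (auto simp: fmeasurableD)
    also have "\<dots> = N * measure lebesgue D" by (simp add: P(2))
    also have "measure lebesgue D \<le> measure lebesgue {x \<in> U. infdist x (frontier U) < d}"
    proof (rule measure_mono_fmeasurable)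
      show "D \<subseteq> {x \<in> U. infdist x (frontier U) < d}"
      proof
        fix x assume "x \<in> D"
        then have "infdist x (frontier U) \<le> dist x (x + t *\<^sub>R e)"
          by (intro infdist_frontier_le_dist) (auto simp: D_def)
        then show "x \<in> {x \<in> U. infdist x (frontier U) < d}"
          using \<open>x \<in> D\<close> t by (simp add: D_def dist_norm e)
      qed
      show "{x \<in> U. infdist x (frontier U) < d} \<in> lmeasurable"
        using open_inner_collar[OF U(1), of d] U(2)
        by (intro lmeasurable_open) (auto intro: bounded_subset)
    qed (use D in auto)
    also have "\<dots> = inner_collar_volume U d"
      using open_inner_collar[OF U(1), of d] by (simp add: inner_collar_volume_def)
    finally have "v \<le> N * inner_collar_volume U d"
      using fm(2)[of U] by (simp add: v_def mult_left_mono)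
    also have "\<dots> \<le> ((T + 1) / d) * inner_collar_volume U d"
      using N d T0 by (intro mult_right_mono) (auto simp: inner_collar_volume_def field_simps)
    finally show "v / (T + 1) * d \<le> inner_collar_volume U d"
      using d T0 by (simp add: field_simps)
  qed
qed

text \<open>Multiplicative constants disappear because \<open>ln C / ln d\<close> tends to 0, and
  upper bounds with every exponent below \<open>s\<close> suffice for the limit. Division by the
  negative \<open>ln d\<close> reverses the inequalities. The quotient in fact converges, so its
  lower limit is \<open>s\<close>.\<close>

lemma inner_minkowski_dim_eqI:
  assumes s: "s > 0" and c: "c > 0" and d0: "d0 > 0"
    and lower: "\<And>d. 0 < d \<Longrightarrow> d < d0 \<Longrightarrow> c * d powr s \<le> inner_collar_volume U d"
    and upper: "\<And>\<sigma>. 0 < \<sigma> \<Longrightarrow> \<sigma> < s \<Longrightarrow>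
      \<exists>C d1. d1 > 0 \<and> (\<forall>d. 0 < d \<longrightarrow> d < d1 \<longrightarrow> inner_collar_volume U d \<le> C * d powr \<sigma>)"
  shows "inner_minkowski_dim U = ereal (4 - s)"
proof -
  let ?V = "inner_collar_volume U"
  let ?q = "\<lambda>d. ln (?V d) / ln d"
  have small: "eventually (\<lambda>d. 0 < d \<and> d < \<epsilon>) (at_right 0)" if "\<epsilon> > 0" for \<epsilon> :: real
    using eventually_at_right_less[of "0::real"] eventually_at_right_real[OF that]
    by eventually_elim auto
  have "(?q \<longlongrightarrow> s) (at_right 0)"
  proof (rule order_tendstoI)
    fix a assume a: "a < s"
    \<comment> \<open>Strictly between \<open>a\<close> and \<open>s\<close>; the maximum keeps it
      positive when \<open>a\<close> is negative.\<close>
    define \<sigma> where "\<sigma> = (max a 0 + s) / 2"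
    have \<sigma>: "0 < \<sigma>" "\<sigma> < s" "a < \<sigma>" using a s by (auto simp: \<sigma>_def)
    obtain C d1 where d1: "d1 > 0" and C: "\<And>d. 0 < d \<Longrightarrow> d < d1 \<Longrightarrow> ?V d \<le> C * d powr \<sigma>"
      using upper[OF \<sigma>(1,2)] by blast
    have "((\<lambda>d. \<sigma> + ln C / ln d) \<longlongrightarrow> \<sigma>) (at_right 0)" by real_asymp
    then have "eventually (\<lambda>d. a < \<sigma> + ln C / ln d) (at_right 0)"
      using \<sigma>(3) by (rule order_tendstoD)
    then show "eventually (\<lambda>d. a < ?q d) (at_right 0)"
      using small[OF d1] small[OF d0] small[of 1, simplified]
    proof eventually_elim
      case (elim d)
      have V: "0 < ?V d" using lower[of d] elim c by (smt (verit) powr_gt_zero mult_pos_pos)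
      then have "0 < C * d powr \<sigma>" using C[of d] elim by linarith
      then have "C > 0" using elim by (simp add: zero_less_mult_iff)
      have "ln (?V d) \<le> ln (C * d powr \<sigma>)" using V C[of d] elim by simp
      also have "\<dots> = ln C + \<sigma> * ln d" using \<open>C > 0\<close> elim by (simp add: ln_mult ln_powr)
      finally have "(ln C + \<sigma> * ln d) / ln d \<le> ?q d"
        using elim by (intro divide_right_mono_neg) auto
      then have "ln C / ln d + \<sigma> \<le> ?q d" using elim by (simp add: add_divide_distrib)
      then show ?case using elim by linarith
    qed
  next
    fix a assume a: "s < a"
    have "((\<lambda>d. s + ln c / ln d) \<longlongrightarrow> s) (at_right 0)" by real_asymp
    then have "eventually (\<lambda>d. s + ln c / ln d < a) (at_right 0)"
      using a by (rule order_tendstoD)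
    then show "eventually (\<lambda>d. ?q d < a) (at_right 0)"
      using small[OF d0] small[of 1, simplified]
    proof eventually_elim
      case (elim d)
      have "ln c + s * ln d = ln (c * d powr s)" using c elim by (simp add: ln_mult ln_powr)
      also have "\<dots> \<le> ln (?V d)" using lower[of d] elim c by (intro ln_mono) auto
      finally have "?q d \<le> (ln c + s * ln d) / ln d"
        using elim by (intro divide_right_mono_neg) auto
      then have "?q d \<le> s + ln c / ln d" using elim by (simp add: add_divide_distrib)
      then show ?case using elim by linarith
    qed
  qed
  then have "Liminf (at_right 0) (\<lambda>d. ereal (?q d)) = ereal s"
    by (intro lim_imp_Liminf) auto
  then show ?thesis by (simp add: inner_minkowski_dim_def)
qed

section \<open>The spiral\<close>

text \<open>Serves in two ways: \<open>decay \<kappa>\<close> bounds the fibre radii and is the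
  angular speed of the spiral, and its square is the derivative of \<open>g\<close>.\<close>

definition decay :: "real \<Rightarrow> real \<Rightarrow> real" where
  "decay \<kappa> t = (1 + t\<^sup>2) powr (- \<kappa> / 2)"

lemma one_plus_square_pos: "0 < 1 + (t::real)\<^sup>2"
  by (smt (verit) zero_le_power2)

lemma decay_square: "(decay \<kappa> t)\<^sup>2 = (1 + t\<^sup>2) powr (- \<kappa>)"
  unfolding decay_def power2_eq_square[of "_ powr _"] powr_add[symmetric] by simp

lemma antiderivative_exists:
  fixes f :: "real \<Rightarrow> real"
  assumes "continuous_on UNIV f"
  shows "\<exists>F. \<forall>t. (F has_real_derivative f t) (at t)"
proof -
  have "\<exists>F. \<forall>x. - \<infinity> < ereal x \<longrightarrow> ereal x < \<infinity> \<longrightarrow> (F has_vector_derivative f x) (at x)"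
    using assms by (intro einterval_antiderivative) (auto simp: continuous_on_eq_continuous_at)
  then have "\<exists>F. \<forall>x. (F has_vector_derivative f x) (at x)" by (elim ex_forward) simp
  then show ?thesis unfolding has_real_derivative_iff_has_vector_derivative .
qed

lemma nondecreasing_of_deriv:
  fixes f :: "real \<Rightarrow> real"
  assumes "a \<le> b" "\<And>t. a \<le> t \<Longrightarrow> t \<le> b \<Longrightarrow> (f has_real_derivative f' t) (at t)"
    "\<And>t. a \<le> t \<Longrightarrow> t \<le> b \<Longrightarrow> 0 \<le> f' t"
  shows "f a \<le> f b"
proof (rule DERIV_nonneg_imp_nondecreasing[OF assms(1)])
  fix x assume "a \<le> x" "x \<le> b"
  with assms(2,3) show "\<exists>y. (f has_real_derivative y) (at x) \<and> 0 \<le> y" by (intro exI[of _ "f' x"]) simp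
qed

text \<open>On \<open>t \<ge> 1\<close> the integrand is at most
  \<open>t powr (- 2 * \<kappa>)\<close>, whose integral from 1 to infinity is
  \<open>1 / (2 * \<kappa> - 1)\<close>.\<close>

lemma bounded_antiderivative_right:
  assumes \<kappa>: "1 / 2 < \<kappa>" and g: "\<And>t. (g has_real_derivative (decay \<kappa> t)\<^sup>2) (at t)" and t: "t \<ge> 1"
  shows "g t \<le> g 1 + 1 / (2 * \<kappa> - 1)"
proof -
  let ?h = "\<lambda>t. - (t powr (1 - 2 * \<kappa>) / (2 * \<kappa> - 1)) - g t"
  have "?h 1 \<le> ?h t"
  proof (rule nondecreasing_of_deriv[OF t])
    fix s :: real assume s: "1 \<le> s"
    show "(?h has_real_derivative (s powr (- 2 * \<kappa>) - (decay \<kappa> s)\<^sup>2)) (at s)"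
    proof -
      have "((\<lambda>t. t powr (1 - 2 * \<kappa>)) has_real_derivative (1 - 2 * \<kappa>) * s powr (1 - 2 * \<kappa> - 1)) (at s)"
        using s by (intro has_real_derivative_powr) auto
      from DERIV_diff[OF DERIV_minus[OF DERIV_cdivide[OF this, of "2 * \<kappa> - 1"]] g]
      show ?thesis by (rule DERIV_cong) (use \<kappa> in \<open>simp add: divide_simps, simp add: algebra_simps\<close>)
    qed
    have "(decay \<kappa> s)\<^sup>2 = (1 + s\<^sup>2) powr (- \<kappa>)" by (rule decay_square)
    also have "\<dots> \<le> (s\<^sup>2) powr (- \<kappa>)"
      using s \<kappa> by (intro powr_mono2') auto
    also have "\<dots> = s powr (- 2 * \<kappa>)"
      using s by (simp add: powr_powr flip: powr_numeral)
    finally show "0 \<le> s powr (- 2 * \<kappa>) - (decay \<kappa> s)\<^sup>2" by simp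
  qed
  then have "g t - g 1 \<le> 1 / (2 * \<kappa> - 1) - t powr (1 - 2 * \<kappa>) / (2 * \<kappa> - 1)" by simp
  also have "\<dots> \<le> 1 / (2 * \<kappa> - 1)" using \<kappa> by simp
  finally show ?thesis by simp
qed

lemma bounded_antiderivative:
  assumes \<kappa>: "1 / 2 < \<kappa>" and g: "\<And>t. (g has_real_derivative (decay \<kappa> t)\<^sup>2) (at t)"
  obtains M where "\<And>t. \<bar>g t\<bar> \<le> M"
proof -
  define C where "C = 1 / (2 * \<kappa> - 1)"
  have C: "C > 0" using \<kappa> by (simp add: C_def)
  have up: "h t \<le> h 1 + C" if h: "\<And>t. (h has_real_derivative (decay \<kappa> t)\<^sup>2) (at t)" for h t
  proof (cases "t \<ge> 1")
    case True
    then show ?thesis using bounded_antiderivative_right[OF \<kappa> h] by (simp add: C_def)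
  next
    case False
    then have "h t \<le> h 1"
      by (intro nondecreasing_of_deriv[OF _ h]) auto
    then show ?thesis using C by simp
  qed
  \<comment> \<open>The integrand is even, so \<open>- g (- t)\<close> is again an antiderivative;
    its upper bound is a lower bound for \<open>g\<close>.\<close>
  have "((\<lambda>t. - g (- t)) has_real_derivative (decay \<kappa> t)\<^sup>2) (at t)" for t
    using DERIV_minus[OF g[of "- t", unfolded DERIV_mirror]] by (simp add: decay_def)
  from up[OF this] up[OF g] have "\<bar>g t\<bar> \<le> max (g 1 + C) (- g (- 1) + C)" for t
    by (smt (verit) minus_minus)
  then show ?thesis by (rule that)
qed

lemma has_vector_derivative_Complex:
  assumes "(a has_real_derivative a') (at t)" "(b has_real_derivative b') (at t)"
  shows "((\<lambda>t. Complex (a t) (b t)) has_vector_derivative Complex a' b') (at t)"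
proof -
  have "((\<lambda>t. a t *\<^sub>R 1 + b t *\<^sub>R \<i>) has_vector_derivative
      ((a t *\<^sub>R 0 + a' *\<^sub>R 1) + (b t *\<^sub>R 0 + b' *\<^sub>R \<i>))) (at t)"
    by (intro has_vector_derivative_add has_vector_derivative_scaleR assms has_vector_derivative_const)
  then show ?thesis by (simp add: Complex_eq scaleR_conv_of_real mult.commute)
qed

lemma smooth_on_decay: "smooth_on UNIV (decay \<kappa>)"
proof -
  have "smooth_on UNIV (\<lambda>t::real. 1 + t * t)"
    by (intro smooth_on_add smooth_on_const smooth_on_mult smooth_on_ident open_UNIV)
  from smooth_on_powr[OF open_UNIV this] show ?thesis
    using one_plus_square_pos unfolding decay_def[abs_def] power2_eq_square by blast
qed

text \<open>\<open>g\<close> provides both the bounded height coordinate of the strip and, up to an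
  affine change, the radius of the spiral; \<open>\<Theta>\<close> is the polar angle of the
  spiral.\<close>

locale folding =
  fixes \<kappa> :: real and g \<Theta> :: "real \<Rightarrow> real" and M :: real
  assumes \<kappa>: "1 / 2 < \<kappa>" "\<kappa> \<le> 1"
    and g_deriv: "\<And>t. (g has_real_derivative (decay \<kappa> t)\<^sup>2) (at t)"
    and \<Theta>_deriv: "\<And>t. (\<Theta> has_real_derivative decay \<kappa> t) (at t)"
    and g_bound: "\<And>t. \<bar>g t\<bar> \<le> M"
begin

abbreviation "\<rho> \<equiv> decay \<kappa>"

lemma \<rho>_pos: "0 < \<rho> t"
  by (smt (verit) decay_def one_plus_square_pos powr_gt_zero)

lemma \<rho>_le_1: "\<rho> t \<le> 1"
  using powr_mono[of "- \<kappa> / 2" 0 "1 + t\<^sup>2"] \<kappa> one_plus_square_pos[of t] by (auto simp: decay_def)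

lemma \<rho>_square: "(\<rho> t)\<^sup>2 = (1 + t\<^sup>2) powr (- \<kappa>)"
  by (rule decay_square)

lemma \<rho>_power_le_1: "\<rho> t ^ n \<le> 1"
  by (rule power_le_one[OF less_imp_le[OF \<rho>_pos] \<rho>_le_1])

definition "\<rho>' t = - \<kappa> * t * (1 + t\<^sup>2) powr (- \<kappa> / 2 - 1)"

lemma \<rho>_deriv: "(\<rho> has_real_derivative \<rho>' t) (at t)"
  unfolding decay_def \<rho>'_def using one_plus_square_pos[of t]
  by (auto intro!: derivative_eq_intros simp: powr_diff field_simps)

text \<open>Since \<open>\<kappa> \<le> 1\<close>, the exponent
  \<open>- \<kappa> / 2 - 1 / 2\<close> is at most \<open>- \<kappa>\<close>. The bound says that
  \<open>\<rho>\<close> changes no faster than \<open>g\<close>, so \<open>g + \<rho>\<close> and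
  \<open>g - \<rho>\<close> are both nondecreasing.\<close>

lemma \<rho>'_bound: "\<bar>\<rho>' t\<bar> \<le> (\<rho> t)\<^sup>2"
proof -
  have "\<bar>t\<bar> \<le> (1 + t\<^sup>2) powr (1 / 2)"
    by (simp add: powr_half_sqrt real_le_rsqrt)
  then have "\<kappa> * \<bar>t\<bar> * (1 + t\<^sup>2) powr (- \<kappa> / 2 - 1) \<le> 1 * (1 + t\<^sup>2) powr (1 / 2) * (1 + t\<^sup>2) powr (- \<kappa> / 2 - 1)"
    using \<kappa> by (intro mult_right_mono mult_mono) auto
  also have "\<dots> = (1 + t\<^sup>2) powr (- \<kappa> / 2 - 1 / 2)"
  proof -
    have eq: "1 / 2 + (- \<kappa> / 2 - 1) = - \<kappa> / 2 - 1 / 2" by simp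
    show ?thesis by (simp only: mult_1 powr_add[symmetric] eq)
  qed
  also have "\<dots> \<le> (1 + t\<^sup>2) powr (- \<kappa>)"
    using \<kappa> by (intro powr_mono) auto
  finally show ?thesis using \<kappa> by (simp add: \<rho>'_def \<rho>_square abs_mult)
qed

lemma \<rho>'_bound_1: "\<bar>\<rho>' t\<bar> \<le> 1"
  using \<rho>'_bound \<rho>_power_le_1 by (rule order_trans)

lemma g_strict_mono: "x < y \<Longrightarrow> g x < g y"
  by (rule DERIV_pos_imp_increasing[of x y g]) (use g_deriv \<rho>_pos in \<open>auto intro!: exI zero_less_power\<close>)

lemma g_mono: "x \<le> y \<Longrightarrow> g x \<le> g y"
  using g_strict_mono[of x y] by (cases "x = y") auto

text \<open>The shift \<open>M + 1\<close> keeps the radius at least 8, and the factor 8 turns a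
  gain of \<open>m / 2\<close> in \<open>g\<close> into the radial gap \<open>4 * m\<close> that
  separates two fibres of radius at most \<open>2 * m\<close>.\<close>

definition "radius t = 8 * (M + 1 + g t)"

lemma radius_bounds: "8 \<le> radius t" "radius t \<le> 16 * M + 8"
  using g_bound[of t] by (auto simp: radius_def)

lemma radius_deriv: "(radius has_real_derivative 8 * (\<rho> t)\<^sup>2) (at t)"
  unfolding radius_def by (auto intro!: derivative_eq_intros g_deriv)

definition spiral :: "real \<Rightarrow> complex" where
  "spiral t = radius t *\<^sub>R cis (\<Theta> t)"

text \<open>The velocity in the frame rotated by \<open>\<Theta> t\<close>: the real part of the
  first factor is radial, the imaginary part tangential.\<close>

definition spiral' :: "real \<Rightarrow> complex" where
  "spiral' t = Complex (8 * (\<rho> t)\<^sup>2) (radius t * \<rho> t) * cis (\<Theta> t)"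

definition spiral'' :: "real \<Rightarrow> complex" where
  "spiral'' t = (Complex (16 * \<rho> t * \<rho>' t) (8 * (\<rho> t)^3 + radius t * \<rho>' t)
     + Complex (8 * (\<rho> t)\<^sup>2) (radius t * \<rho> t) * (\<i> * \<rho> t)) * cis (\<Theta> t)"

lemma cis_\<Theta>_deriv: "((\<lambda>t. cis (\<Theta> t)) has_vector_derivative (\<i> * \<rho> t * cis (\<Theta> t))) (at t)"
  unfolding has_vector_derivative_def
  by (auto intro!: derivative_eq_intros \<Theta>_deriv[unfolded has_field_derivative_def]
      simp: scaleR_conv_of_real)

lemma spiral_deriv: "(spiral has_vector_derivative spiral' t) (at t)"
proof -
  have "(spiral has_vector_derivative (radius t *\<^sub>R (\<i> * \<rho> t * cis (\<Theta> t)) + (8 * (\<rho> t)\<^sup>2) *\<^sub>R cis (\<Theta> t))) (at t)"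
    unfolding spiral_def
    by (intro has_vector_derivative_scaleR radius_deriv cis_\<Theta>_deriv)
  then show ?thesis
    by (simp add: spiral'_def complex_eq_iff scaleR_conv_of_real algebra_simps Complex_eq)
qed

lemma spiral'_deriv: "(spiral' has_vector_derivative spiral'' t) (at t)"
proof -
  have 1: "((\<lambda>t. Complex (8 * (\<rho> t)\<^sup>2) (radius t * \<rho> t)) has_vector_derivative
      Complex (16 * \<rho> t * \<rho>' t) (8 * (\<rho> t)^3 + radius t * \<rho>' t)) (at t)"
  proof (rule has_vector_derivative_Complex)
    show "((\<lambda>t. 8 * (\<rho> t)\<^sup>2) has_real_derivative 16 * \<rho> t * \<rho>' t) (at t)"
      by (auto intro!: derivative_eq_intros \<rho>_deriv)
    show "((\<lambda>t. radius t * \<rho> t) has_real_derivative 8 * (\<rho> t)^3 + radius t * \<rho>' t) (at t)"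
      by (auto intro!: derivative_eq_intros radius_deriv \<rho>_deriv simp: power2_eq_square power3_eq_cube)
  qed
  show ?thesis
    using has_vector_derivative_mult[OF 1 cis_\<Theta>_deriv[of t]]
    unfolding spiral'_def[abs_def] spiral''_def by (simp add: algebra_simps)
qed

text \<open>Two passes of the spiral one period apart are separated radially, by the growth of the radius,
  unless the polar angle has changed little between them; then they are separated tangentially.\<close>

lemma spiral_separation:
  assumes xy: "x + 2 * pi \<le> y"
  shows "2 * \<rho> x + 2 * \<rho> y \<le> norm (spiral x - spiral y)"
proof -
  define m where "m = max (\<rho> x) (\<rho> y)"
  define D where "D = g y - g x"
  define \<Delta> where "\<Delta> = \<Theta> y - \<Theta> x"
  have m: "0 < m" "2 * \<rho> x + 2 * \<rho> y \<le> 4 * m" using \<rho>_pos[of x] by (auto simp: m_def)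
  have le: "x \<le> y" using xy pi_gt_zero by linarith
  have rad: "8 * D \<le> norm (spiral x - spiral y)"
  proof -
    have "8 * D = radius y - radius x" by (simp add: radius_def D_def)
    also have "\<dots> = norm (spiral y) - norm (spiral x)"
      using radius_bounds(1)[of x] radius_bounds(1)[of y] by (simp add: spiral_def)
    also have "\<dots> \<le> norm (spiral x - spiral y)"
      by (metis norm_minus_commute norm_triangle_ineq2)
    finally show ?thesis .
  qed
  show ?thesis
  \<comment> \<open>If \<open>g\<close> grows by at least \<open>m / 2\<close>, the radial gap
    \<open>8 * D\<close> is enough. Otherwise the whole interval is shown to contribute a small but
    definite turn.\<close>
  proof (cases "m / 2 \<le> D")
    case True
    then show ?thesis using rad m by linarith
  next
    case False
    \<comment> \<open>By monotonicity of \<open>g + \<rho>\<close> and \<open>g - \<rho>\<close>,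
      the value of \<open>\<rho>\<close> inside the interval falls short of either end value by at
      most \<open>D < m / 2\<close>.\<close>
    have low: "m / 2 \<le> \<rho> t" if t: "x \<le> t" "t \<le> y" for t
    proof -
      have "\<rho> x + g x \<le> \<rho> t + g t"
      proof (rule nondecreasing_of_deriv[OF t(1)])
        show "((\<lambda>t. \<rho> t + g t) has_real_derivative (\<rho>' s + (\<rho> s)\<^sup>2)) (at s)" for s
          by (intro DERIV_add \<rho>_deriv g_deriv)
        show "0 \<le> \<rho>' s + (\<rho> s)\<^sup>2" for s using \<rho>'_bound[of s] by linarith
      qed
      moreover have "g t - \<rho> t \<le> g y - \<rho> y"
      proof (rule nondecreasing_of_deriv[OF t(2)])
        show "((\<lambda>t. g t - \<rho> t) has_real_derivative ((\<rho> s)\<^sup>2 - \<rho>' s)) (at s)" for s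
          by (intro DERIV_diff \<rho>_deriv g_deriv)
        show "0 \<le> (\<rho> s)\<^sup>2 - \<rho>' s" for s using \<rho>'_bound[of s] by linarith
      qed
      ultimately show ?thesis
        using False g_mono[OF t(1)] g_mono[OF t(2)] by (auto simp: D_def m_def)
    qed
    \<comment> \<open>The angular speed is at least \<open>m / 2\<close> on an interval of length at
      least \<open>2 * pi\<close>, so the turn is at least \<open>m * pi\<close>.\<close>
    have "\<Theta> x - m / 2 * x \<le> \<Theta> y - m / 2 * y"
    proof (rule nondecreasing_of_deriv[OF le])
      show "((\<lambda>t. \<Theta> t - m / 2 * t) has_real_derivative (\<rho> s - m / 2)) (at s)" for s
        by (auto intro!: derivative_eq_intros \<Theta>_deriv)
    qed (use low in auto)
    then have "m / 2 * (y - x) \<le> \<Delta>" unfolding \<Delta>_def right_diff_distrib by linarith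
    moreover have "m / 2 * (2 * pi) \<le> m / 2 * (y - x)" using xy m by (intro mult_left_mono) auto
    ultimately have \<Delta>: "m * pi \<le> \<Delta>" by simp
    \<comment> \<open>The derivative of \<open>g\<close> is at least \<open>m / 2\<close> times that
      of \<open>\<Theta>\<close>, so \<open>D < m / 2\<close> forces a turn below 1, too small to
      come back around.\<close>
    have "g x - m / 2 * \<Theta> x \<le> g y - m / 2 * \<Theta> y"
    proof (rule nondecreasing_of_deriv[OF le])
      show "((\<lambda>t. g t - m / 2 * \<Theta> t) has_real_derivative ((\<rho> s)\<^sup>2 - m / 2 * \<rho> s)) (at s)" for s
        by (auto intro!: derivative_eq_intros \<Theta>_deriv g_deriv)
      show "0 \<le> (\<rho> s)\<^sup>2 - m / 2 * \<rho> s" if "x \<le> s" "s \<le> y" for s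
        using low[OF that] \<rho>_pos[of s] by (simp add: power2_eq_square mult_right_mono)
    qed
    then have "m / 2 * \<Delta> \<le> D" unfolding \<Delta>_def D_def right_diff_distrib by linarith
    then have "m / 2 * \<Delta> < m / 2 * 1" using False by simp
    then have "\<Delta> < 1" using m(1) by (simp only: mult_less_cancel_left_pos half_gt_zero)
    have "0 \<le> \<Delta>" using \<Delta> m pi_gt_zero by (smt (verit) mult_pos_pos)
    \<comment> \<open>The cosine is at least 1/2 up to \<open>pi / 3 > 1\<close>, whence
      \<open>sin \<Delta> \<ge> \<Delta> / 2\<close>.\<close>
    have "sin 0 - 0 / 2 \<le> sin \<Delta> - \<Delta> / 2"
    proof (rule nondecreasing_of_deriv[OF \<open>0 \<le> \<Delta>\<close>])
      show "((\<lambda>t. sin t - t / 2) has_real_derivative (cos s - 1 / 2)) (at s)" for s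
        by (auto intro!: derivative_eq_intros)
      show "0 \<le> cos s - 1 / 2" if "0 \<le> s" "s \<le> \<Delta>" for s
        using cos_monotone_0_pi_le[of s "pi / 3"] that \<open>\<Delta> < 1\<close> pi_gt3 by (simp add: cos_60)
    qed
    then have sin: "\<Delta> / 2 \<le> sin \<Delta>" by simp
    have "4 * m \<le> 4 * \<Delta>" using \<Delta> m pi_gt3 by (smt (verit) mult_le_cancel_left1)
    also have "\<dots> = 8 * (\<Delta> / 2)" by simp
    also have "\<dots> \<le> radius y * sin \<Delta>"
      using radius_bounds(1)[of y] sin \<open>0 \<le> \<Delta>\<close> by (intro mult_mono) auto
    \<comment> \<open>Rotating \<open>spiral x\<close> onto the real axis removes it from the
      imaginary part, which leaves the tangential displacement of \<open>spiral y\<close>.\<close>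
    also have "\<dots> = Im ((spiral y - spiral x) * cis (- \<Theta> x))"
      by (simp add: spiral_def \<Delta>_def sin_diff algebra_simps)
    also have "\<dots> \<le> norm ((spiral y - spiral x) * cis (- \<Theta> x))"
      using abs_Im_le_cmod abs_le_D1 by blast
    also have "\<dots> = norm (spiral x - spiral y)"
      by (simp add: norm_mult norm_minus_commute)
    finally show ?thesis using m by linarith
  qed
qed

text \<open>One constant for both derivatives of the spiral: the estimates below give
  \<open>16 * M + 16\<close> for \<open>spiral'\<close> and \<open>32 * M + 48\<close> for
  \<open>spiral''\<close>.\<close>

definition "Lip = 32 * M + 64"

lemma M_nonneg: "0 \<le> M" using g_bound[of 0] by linarith

lemma norm_Complex_le: "norm (Complex a b) \<le> \<bar>a\<bar> + \<bar>b\<bar>"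
  using cmod_le[of "Complex a b"] by simp

lemma radius_mult_le: "\<bar>s\<bar> \<le> 1 \<Longrightarrow> \<bar>radius t * s\<bar> \<le> 16 * M + 8"
  using radius_bounds[of t] mult_mono[of "radius t" "16 * M + 8" "\<bar>s\<bar>" 1] M_nonneg by (simp add: abs_mult)

lemma norm_spiral: "norm (spiral t) \<le> 16 * M + 8"
  using radius_bounds[of t] by (simp add: spiral_def)

lemma norm_spiral'_aux: "norm (Complex (8 * (\<rho> t)\<^sup>2) (radius t * \<rho> t)) \<le> 16 * M + 16"
proof -
  have "\<bar>8 * (\<rho> t)\<^sup>2\<bar> \<le> 8" using \<rho>_power_le_1[of t 2] by (simp add: abs_mult)
  moreover have "\<bar>radius t * \<rho> t\<bar> \<le> 16 * M + 8"
    using \<rho>_pos[of t] \<rho>_le_1[of t] by (intro radius_mult_le) (simp add: abs_of_pos)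
  ultimately show ?thesis using norm_Complex_le[of "8 * (\<rho> t)\<^sup>2" "radius t * \<rho> t"] by linarith
qed

lemma norm_spiral': "norm (spiral' t) \<le> Lip"
  using norm_spiral'_aux[of t] M_nonneg by (simp add: spiral'_def norm_mult Lip_def)

lemma norm_spiral'': "norm (spiral'' t) \<le> Lip"
proof -
  note r = \<rho>_pos[of t] \<rho>_le_1[of t]
  have "\<bar>16 * \<rho> t * \<rho>' t\<bar> \<le> 16 * 1 * 1"
    unfolding abs_mult using r \<rho>'_bound_1[of t] by (intro mult_mono) auto
  moreover have "\<bar>8 * (\<rho> t)^3\<bar> \<le> 8" using \<rho>_power_le_1[of t 3] \<rho>_pos[of t] by (simp add: abs_mult)
  moreover have "\<bar>radius t * \<rho>' t\<bar> \<le> 16 * M + 8" by (intro radius_mult_le \<rho>'_bound_1)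
  ultimately have 1: "norm (Complex (16 * \<rho> t * \<rho>' t) (8 * (\<rho> t)^3 + radius t * \<rho>' t)) \<le> 16 * M + 32"
    using norm_Complex_le[of "16 * \<rho> t * \<rho>' t" "8 * (\<rho> t)^3 + radius t * \<rho>' t"] by linarith
  have "norm (Complex (8 * (\<rho> t)\<^sup>2) (radius t * \<rho> t)) * \<rho> t \<le> (16 * M + 16) * 1"
    using norm_spiral'_aux[of t] r M_nonneg by (intro mult_mono) auto
  then have "norm (Complex (8 * (\<rho> t)\<^sup>2) (radius t * \<rho> t) * (\<i> * \<rho> t)) \<le> 16 * M + 16"
    using r by (simp add: norm_mult)
  with 1 have "norm (Complex (16 * \<rho> t * \<rho>' t) (8 * (\<rho> t)^3 + radius t * \<rho>' t)
     + Complex (8 * (\<rho> t)\<^sup>2) (radius t * \<rho> t) * (\<i> * \<rho> t)) \<le> (16 * M + 32) + (16 * M + 16)"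
    by (rule norm_triangle_mono)
  then show ?thesis by (simp add: spiral''_def norm_mult Lip_def)
qed

lemma lipschitz_of_vector_derivative:
  fixes f :: "real \<Rightarrow> complex"
  assumes "\<And>t. (f has_vector_derivative f' t) (at t)" "\<And>t. norm (f' t) \<le> B"
  shows "norm (f x - f y) \<le> B * \<bar>x - y\<bar>"
proof -
  have "norm (f x - f y) \<le> B * norm (x - y)"
  proof (rule differentiable_bound[of UNIV])
    show "(f has_derivative (\<lambda>h. h *\<^sub>R f' t)) (at t within UNIV)" for t
      using assms(1)[of t] by (simp add: has_vector_derivative_def)
    show "onorm (\<lambda>h. h *\<^sub>R f' t) \<le> B" for t
      using assms(2)[of t] by (intro onorm_le) (simp add: mult.commute[of B] mult_left_mono)
  qed auto
  then show ?thesis by simp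
qed

lemma spiral_lipschitz: "norm (spiral x - spiral y) \<le> Lip * \<bar>x - y\<bar>"
  by (rule lipschitz_of_vector_derivative[OF spiral_deriv norm_spiral'])

lemma spiral'_lipschitz: "norm (spiral' x - spiral' y) \<le> Lip * \<bar>x - y\<bar>"
  by (rule lipschitz_of_vector_derivative[OF spiral'_deriv norm_spiral''])

section \<open>Smoothness of the spiral\<close>

lemma smooth_on_\<rho>_square: "smooth_on UNIV (\<lambda>t. (\<rho> t)\<^sup>2)"
  unfolding power2_eq_square by (intro smooth_on_mult smooth_on_decay) auto

lemma smooth_on_g: "smooth_on UNIV g"
  by (rule smooth_on_of_real_derivative[OF open_UNIV _ smooth_on_\<rho>_square])
    (rule g_deriv[unfolded has_real_derivative_iff_has_vector_derivative])

lemma smooth_on_\<Theta>: "smooth_on UNIV \<Theta>"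
  by (rule smooth_on_of_real_derivative[OF open_UNIV _ smooth_on_decay])
    (rule \<Theta>_deriv[unfolded has_real_derivative_iff_has_vector_derivative])

lemma smooth_on_radius: "smooth_on UNIV radius"
  unfolding radius_def[abs_def] by (intro smooth_on_mult smooth_on_add smooth_on_const smooth_on_g) auto

lemma smooth_on_spiral: "smooth_on UNIV spiral"
  unfolding spiral_def[abs_def]
  by (intro smooth_on_scaleR smooth_on_radius smooth_on_cis smooth_on_\<Theta>) auto

lemma smooth_on_spiral': "smooth_on UNIV spiral'"
proof -
  have eq: "spiral' = (\<lambda>t. (8 * (\<rho> t)\<^sup>2) *\<^sub>R cis (\<Theta> t) + (radius t * \<rho> t) *\<^sub>R (\<i> * cis (\<Theta> t)))"
    by (rule ext) (simp add: spiral'_def Complex_eq scaleR_conv_of_real algebra_simps)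
  have cis: "smooth_on UNIV (\<lambda>t. cis (\<Theta> t))" by (intro smooth_on_cis smooth_on_\<Theta>) auto
  have "smooth_on UNIV (\<lambda>t. \<i> * cis (\<Theta> t))"
    by (rule smooth_on_bounded_linear[OF _ bounded_linear_mult_right cis]) simp
  then show ?thesis
    unfolding eq
    by (intro smooth_on_add smooth_on_scaleR smooth_on_mult smooth_on_const smooth_on_\<rho>_square smooth_on_decay
        smooth_on_radius cis) auto
qed

end

section \<open>The folding map\<close>

definition symplectic_on :: "complex2 set \<Rightarrow> (complex2 \<Rightarrow> complex2) \<Rightarrow> bool" where
  "symplectic_on S f \<longleftrightarrow> smooth_on S f \<and> (\<forall>x\<in>S. symplectic_linear (frechet_derivative f (at x)))"

lemma symplectic_onI:
  assumes "smooth_on S f" "\<And>x. x \<in> S \<Longrightarrow> (f has_derivative F x) (at x)"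
    "\<And>x u v. x \<in> S \<Longrightarrow> omega_std (F x u) (F x v) = omega_std u v"
  shows "symplectic_on S f"
  unfolding symplectic_on_def symplectic_linear_def
proof (intro conjI ballI allI assms(1))
  fix x u v assume x: "x \<in> S"
  have eq: "F x = frechet_derivative f (at x)" by (rule frechet_derivative_at[OF assms(2)[OF x]])
  show "linear (frechet_derivative f (at x))"
    unfolding eq[symmetric] by (rule has_derivative_linear[OF assms(2)[OF x]])
  show "omega_std (frechet_derivative f (at x) u) (frechet_derivative f (at x) v) = omega_std u v"
    unfolding eq[symmetric] by (rule assms(3)[OF x])
qed

lemma symplectic_on_compose:
  assumes "open S" "open T" "symplectic_on T f" "symplectic_on S h" "h ` S \<subseteq> T"
  shows "symplectic_on S (\<lambda>x. f (h x))"
proof (rule symplectic_onI)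
  have sm: "smooth_on T f" "smooth_on S h"
    and sy: "\<And>y. y \<in> T \<Longrightarrow> symplectic_linear (frechet_derivative f (at y))"
      "\<And>x. x \<in> S \<Longrightarrow> symplectic_linear (frechet_derivative h (at x))"
    using assms(3,4) unfolding symplectic_on_def by blast+
  show "smooth_on S (\<lambda>x. f (h x))" by (rule smooth_on_compose[OF assms(1,2) sm assms(5)])
  fix x assume x: "x \<in> S"
  then have hx: "h x \<in> T" using assms(5) by blast
  show "((\<lambda>x. f (h x)) has_derivative
      (\<lambda>v. frechet_derivative f (at (h x)) (frechet_derivative h (at x) v))) (at x)"
    by (rule has_derivative_compose[OF smooth_on_imp_has_derivative[OF sm(2) x]
          smooth_on_imp_has_derivative[OF sm(1) hx]])
  show "omega_std (frechet_derivative f (at (h x)) (frechet_derivative h (at x) u))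
      (frechet_derivative f (at (h x)) (frechet_derivative h (at x) v)) = omega_std u v" for u v
    using symplectic_linear_compose[OF sy(1)[OF hx] sy(2)[OF x]] unfolding symplectic_linear_def by blast
qed

lemma symplectic_on_subset: "symplectic_on S f \<Longrightarrow> T \<subseteq> S \<Longrightarrow> symplectic_on T f"
  unfolding symplectic_on_def using smooth_on_subset by blast

lemma smooth_on_Complex:
  "open S \<Longrightarrow> smooth_on S f \<Longrightarrow> smooth_on S h \<Longrightarrow> smooth_on S (\<lambda>x. Complex (f x) (h x))"
  unfolding smooth_on_def using Ck_on_Complex by blast

lemma smooth_on_sqrt:
  fixes f :: "'a::euclidean_space \<Rightarrow> real"
  assumes "open S" "smooth_on S f" "\<And>x. x \<in> S \<Longrightarrow> f x > 0"
  shows "smooth_on S (\<lambda>x. sqrt (f x))"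
  unfolding smooth_on_def
proof
  fix k
  have "Ck_on k S (\<lambda>x. f x powr (1 / 2))"
    using smooth_on_powr[OF assms] unfolding smooth_on_def by blast
  then show "Ck_on k S (\<lambda>x. sqrt (f x))"
    by (rule Ck_on_cong[OF assms(1), rotated]) (simp add: powr_half_sqrt less_imp_le[OF assms(3)])
qed

lemma smooth_on_mult_complex:
  fixes f h :: "'a::euclidean_space \<Rightarrow> complex"
  assumes "open S" "smooth_on S f" "smooth_on S h"
  shows "smooth_on S (\<lambda>x. f x * h x)"
proof -
  have "f x * h x = Complex (Re (f x) * Re (h x) - Im (f x) * Im (h x)) (Re (f x) * Im (h x) + Im (f x) * Re (h x))" for x
    by (simp add: complex_eq_iff)
  then show ?thesis
    by (simp only:) (intro smooth_on_Complex smooth_on_add smooth_on_diff smooth_on_mult assms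
      smooth_on_bounded_linear[OF assms(1) bounded_linear_Re] smooth_on_bounded_linear[OF assms(1) bounded_linear_Im])
qed

lemma has_derivative_Complex:
  assumes "(a has_derivative a') F" "(b has_derivative b') F"
  shows "((\<lambda>x. Complex (a x) (b x)) has_derivative (\<lambda>h. Complex (a' h) (b' h))) F"
proof -
  have "((\<lambda>x. a x *\<^sub>R 1 + b x *\<^sub>R \<i>) has_derivative (\<lambda>h. a' h *\<^sub>R 1 + b' h *\<^sub>R \<i>)) F"
    by (intro has_derivative_add has_derivative_scaleR_left assms)
  then show ?thesis by (simp add: Complex_eq scaleR_conv_of_real mult.commute)
qed

lemmas bounded_linear_coordinates =
  bounded_linear_compose[OF bounded_linear_Re bounded_linear_fst]
  bounded_linear_compose[OF bounded_linear_Im bounded_linear_fst]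
  bounded_linear_compose[OF bounded_linear_cnj bounded_linear_snd]
  bounded_linear_fst bounded_linear_snd

lemmas smooth_on_coordinates =
  bounded_linear_coordinates[THEN smooth_on_linear[rotated]]

lemmas has_derivative_coordinates =
  bounded_linear_coordinates[THEN bounded_linear_imp_has_derivative]

context folding
begin

text \<open>The factor is the reciprocal of \<open>(\<rho> (Im z))\<^sup>2\<close>, so passing from
  \<open>z\<close> to the pair of \<open>flat z\<close> and \<open>g (Im z)\<close> preserves
  area.\<close>

definition flat :: "complex \<Rightarrow> real" where
  "flat z = Re z * (1 + (Im z)\<^sup>2) powr \<kappa>"

definition stage1 :: "complex2 \<Rightarrow> complex2" where
  "stage1 q = (Complex (flat (fst q)) (g (Im (fst q))), snd q)"

text \<open>Translating \<open>w\<close> by an amount depending on \<open>x\<close> creates terms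
  pairing dx with dw in the form; the shear of \<open>y\<close> by a term linear in \<open>w\<close>
  cancels them.\<close>

definition stage2 :: "complex2 \<Rightarrow> complex2" where
  "stage2 q = (Complex (Re (fst q)) (Im (fst q) + Im (spiral' (Re (fst q)) * cnj (snd q))),
     snd q + spiral (Re (fst q)))"

text \<open>Heights are at most \<open>M + 2 * Lip\<close> when the norm of \<open>w\<close> is at
  most 2; the extra 1 keeps the radicand in \<open>stage3\<close> at least 2 there.\<close>

definition "rim = M + 2 * Lip + 1"

text \<open>Polar coordinates in which half the squared radius is \<open>rim - y\<close>. The area
  form s ds dx equals dx dy, with the sign made right by letting the radius decrease with
  \<open>y\<close>.\<close>

definition stage3 :: "complex2 \<Rightarrow> complex2" where
  "stage3 q = (sqrt (2 * (rim - Im (fst q))) *\<^sub>R cis (Re (fst q)), snd q)"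

lemma smooth_on_flat: "smooth_on UNIV (\<lambda>q::complex2. flat (fst q))"
  unfolding flat_def power2_eq_square
  by (intro smooth_on_mult smooth_on_powr smooth_on_add smooth_on_const smooth_on_coordinates open_UNIV)
    (use one_plus_square_pos in \<open>simp add: power2_eq_square\<close>)

section \<open>The three stages are symplectic\<close>

lemma symplectic_stage1: "symplectic_on UNIV stage1"
proof (rule symplectic_onI)
  show "smooth_on UNIV stage1"
    unfolding stage1_def
    by (intro smooth_on_Pair smooth_on_Complex smooth_on_flat smooth_on_compose_UNIV[OF _ smooth_on_g]
        smooth_on_coordinates open_UNIV)
  fix q :: complex2
  define v where "v = Im (fst q)"
  have g: "(1 + v\<^sup>2) powr \<kappa> * (\<rho> v)\<^sup>2 = 1"
    using one_plus_square_pos[of v] by (simp add: \<rho>_square powr_minus)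
  have p: "((\<lambda>t. (1 + t\<^sup>2) powr \<kappa>) has_real_derivative (\<kappa> * (1 + v\<^sup>2) powr (\<kappa> - 1) * (2 * v))) (at v)"
    using one_plus_square_pos[of v] by (auto intro!: derivative_eq_intros simp: powr_diff)
  let ?A = "\<lambda>h::complex2. Re (fst q) * (Im (fst h) * (\<kappa> * (1 + v\<^sup>2) powr (\<kappa> - 1) * (2 * v)))
      + Re (fst h) * (1 + v\<^sup>2) powr \<kappa>"
  let ?F = "\<lambda>h::complex2. (Complex (?A h) (Im (fst h) * (\<rho> v)\<^sup>2), snd h)"
  show "(stage1 has_derivative ?F) (at q)"
    unfolding stage1_def flat_def v_def
    by (intro has_derivative_Pair has_derivative_Complex has_derivative_mult has_derivative_coordinates
       DERIV_compose_FDERIV[where g="\<lambda>q. Im (fst q)" and x=q, OF p[unfolded v_def]]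
       DERIV_compose_FDERIV[where g="\<lambda>q. Im (fst q)", OF g_deriv])
  have "omega_std (?F h) (?F k) = ((1 + v\<^sup>2) powr \<kappa> * (\<rho> v)\<^sup>2) * (Re (fst h) * Im (fst k) - Im (fst h) * Re (fst k))
     + (Re (snd h) * Im (snd k) - Im (snd h) * Re (snd k))" for h k
    by (simp add: omega_std_def algebra_simps)
  then show "omega_std (?F h) (?F k) = omega_std h k" for h k
    unfolding g by (simp add: omega_std_def)
qed

lemma symplectic_stage2: "symplectic_on UNIV stage2"
proof (rule symplectic_onI)
  show "smooth_on UNIV stage2"
    unfolding stage2_def
    by (intro smooth_on_Pair smooth_on_Complex smooth_on_add smooth_on_mult_complex
        smooth_on_bounded_linear[OF open_UNIV bounded_linear_Im]
        smooth_on_compose_UNIV[OF _ smooth_on_spiral] smooth_on_compose_UNIV[OF _ smooth_on_spiral']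
        smooth_on_coordinates open_UNIV)
  fix q :: complex2
  define x where "x = Re (fst q)"
  define w where "w = snd q"
  let ?B = "\<lambda>h::complex2. Im (fst h) + Im (spiral' x * cnj (snd h) + Re (fst h) *\<^sub>R spiral'' x * cnj w)"
  let ?F = "\<lambda>h::complex2. (Complex (Re (fst h)) (?B h), snd h + Re (fst h) *\<^sub>R spiral' x)"
  have comp: "((\<lambda>q::complex2. f (Re (fst q))) has_derivative (\<lambda>h. Re (fst h) *\<^sub>R f' x)) (at q)"
    if "\<And>t. (f has_vector_derivative f' t) (at t)" for f :: "real \<Rightarrow> complex" and f'
    unfolding x_def
    by (rule has_derivative_compose[OF has_derivative_coordinates(1) that[unfolded has_vector_derivative_def]])
  show "(stage2 has_derivative ?F) (at q)"
    unfolding stage2_def w_def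
    by (intro has_derivative_Pair has_derivative_Complex has_derivative_add has_derivative_coordinates
        bounded_linear.has_derivative[OF bounded_linear_Im] comp[OF spiral_deriv]
        has_derivative_mult[OF comp[OF spiral'_deriv] has_derivative_coordinates(3), folded x_def])
  \<comment> \<open>The \<open>spiral''\<close> term is a multiple of dx and drops out by
    antisymmetry; the \<open>spiral'\<close> terms from the shear and from the translation
    cancel.\<close>
  show "omega_std (?F h) (?F k) = omega_std h k" for h k
    by (simp add: omega_std_def algebra_simps)
qed

lemma symplectic_stage3: "symplectic_on {q. Im (fst q) < rim} stage3"
proof (rule symplectic_onI)
  have op: "open {q::complex2. Im (fst q) < rim}"
    by (intro open_Collect_less continuous_intros)
  show "smooth_on {q. Im (fst q) < rim} stage3"
    unfolding stage3_def
    by (intro smooth_on_Pair smooth_on_scaleR smooth_on_sqrt smooth_on_mult smooth_on_diff smooth_on_const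
        smooth_on_cis smooth_on_coordinates op) simp
  fix q :: complex2 assume q: "q \<in> {q. Im (fst q) < rim}"
  define s where "s = sqrt (2 * (rim - Im (fst q)))"
  have s: "s > 0" using q by (simp add: s_def)
  define c where "c = cis (Re (fst q))"
  have c: "(Re c)\<^sup>2 + (Im c)\<^sup>2 = 1" by (simp add: c_def)
  have sq: "((\<lambda>t. sqrt (2 * (rim - t))) has_real_derivative - 1 / s) (at (Im (fst q)))"
    using q unfolding s_def by (auto intro!: derivative_eq_intros simp: field_simps)
  have ci: "((\<lambda>q::complex2. cis (Re (fst q))) has_derivative (\<lambda>h. Re (fst h) *\<^sub>R (\<i> * c))) (at q)"
    unfolding c_def by (rule has_derivative_compose[OF has_derivative_coordinates(1)])
      (auto intro!: derivative_eq_intros)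
  let ?F = "\<lambda>h::complex2. (s *\<^sub>R (Re (fst h) *\<^sub>R (\<i> * c)) + (Im (fst h) * (- 1 / s)) *\<^sub>R c, snd h)"
  show "(stage3 has_derivative ?F) (at q)"
    unfolding stage3_def s_def c_def
    by (intro has_derivative_Pair has_derivative_scaleR ci[unfolded c_def] has_derivative_coordinates
        DERIV_compose_FDERIV[where g="\<lambda>q. Im (fst q)" and x=q, OF sq[unfolded s_def]])
  have "omega_std (?F h) (?F k) = ((Re c)\<^sup>2 + (Im c)\<^sup>2) * (Re (fst h) * Im (fst k) - Im (fst h) * Re (fst k))
     + (Re (snd h) * Im (snd k) - Im (snd h) * Re (snd k))" for h k
    using s by (simp add: omega_std_def field_simps power2_eq_square)
  then show "omega_std (?F h) (?F k) = omega_std h k" for h k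
    unfolding c by (simp add: omega_std_def)
qed

section \<open>The composed map: injectivity and variation along fibres\<close>

definition height :: "complex2 \<Rightarrow> real" where
  "height q = g (Im (fst q)) + Im (spiral' (flat (fst q)) * cnj (snd q))"

definition fold_map :: "complex2 \<Rightarrow> complex2" where
  "fold_map q = (sqrt (2 * (rim - height q)) *\<^sub>R cis (flat (fst q)), snd q + spiral (flat (fst q)))"

text \<open>The factor 2 leaves room beyond the fibres of the domain, whose radius is at most
  \<open>\<rho>\<close>. Injectivity on this larger set supplies points outside the image close to
  its boundary.\<close>

definition tube :: "complex2 set" where
  "tube = {q. norm (snd q) < 2 * \<rho> (flat (fst q))}"

lemma fold_map_eq: "fold_map q = stage3 (stage2 (stage1 q))"
  by (simp add: fold_map_def stage1_def stage2_def stage3_def height_def)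

lemma open_tube: "open tube"
  unfolding tube_def
  by (intro open_Collect_less continuous_intros
      continuous_on_compose2[OF smooth_on_imp_continuous_on[OF smooth_on_decay] smooth_on_imp_continuous_on[OF smooth_on_flat]])
    auto

lemma Im_mult_cnj_le: "\<bar>Im (a * cnj b)\<bar> \<le> norm a * norm b"
  using abs_Im_le_cmod[of "a * cnj b"] by (simp add: norm_mult)

lemma Lip_pos: "0 < Lip" using M_nonneg by (simp add: Lip_def)

lemma height_bound:
  assumes "norm (snd q) \<le> 2" shows "height q \<le> rim - 1"
proof -
  have "\<bar>Im (spiral' (flat (fst q)) * cnj (snd q))\<bar> \<le> Lip * 2"
    using Im_mult_cnj_le norm_spiral' assms Lip_pos by (meson order_trans mult_mono norm_ge_zero less_imp_le)
  then show ?thesis using g_bound[of "Im (fst q)"] by (simp add: height_def rim_def)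
qed

lemma tube_norm_le: "q \<in> tube \<Longrightarrow> norm (snd q) \<le> 2"
  using \<rho>_le_1[of "flat (fst q)"] by (simp add: tube_def)

lemma symplectic_fold_map: "symplectic_on tube fold_map"
proof -
  have 1: "symplectic_on tube (\<lambda>q. stage2 (stage1 q))"
    by (rule symplectic_on_compose[OF open_tube open_UNIV symplectic_stage2 symplectic_on_subset[OF symplectic_stage1]]) auto
  have "symplectic_on tube (\<lambda>q. stage3 (stage2 (stage1 q)))"
  proof (rule symplectic_on_compose[OF open_tube _ symplectic_stage3 1])
    show "open {q::complex2. Im (fst q) < rim}"
      by (intro open_Collect_less continuous_intros)
    have "height q < rim" if "q \<in> tube" for q
      using height_bound[OF tube_norm_le[OF that]] by simp
    then show "(\<lambda>q. stage2 (stage1 q)) ` tube \<subseteq> {q. Im (fst q) < rim}"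
      by (auto simp: height_def stage1_def stage2_def)
  qed
  then show ?thesis by (simp add: fold_map_eq[abs_def])
qed

text \<open>Equal polar angles mean that the two \<open>x\<close> differ by a multiple of
  \<open>2 * pi\<close>, and \<open>spiral_separation\<close> excludes every nonzero multiple. Then
  \<open>w\<close>, the height, \<open>Im\<close> and \<open>Re\<close> of the base point are
  recovered in turn.\<close>

lemma inj_on_fold_map: "inj_on fold_map tube"
proof (rule inj_onI)
  fix q1 q2 assume q: "q1 \<in> tube" "q2 \<in> tube" and eq: "fold_map q1 = fold_map q2"
  define x1 x2 where "x1 = flat (fst q1)" and "x2 = flat (fst q2)"
  define s1 s2 where "s1 = sqrt (2 * (rim - height q1))" and "s2 = sqrt (2 * (rim - height q2))"
  have s: "s1 > 0" "s2 > 0"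
    using height_bound[OF tube_norm_le[OF q(1)]] height_bound[OF tube_norm_le[OF q(2)]]
    by (auto simp: s1_def s2_def)
  have e1: "s1 *\<^sub>R cis x1 = s2 *\<^sub>R cis x2" and e2: "snd q1 + spiral x1 = snd q2 + spiral x2"
    using eq by (simp_all add: fold_map_def s1_def s2_def x1_def x2_def)
  from e1 have "norm (s1 *\<^sub>R cis x1) = norm (s2 *\<^sub>R cis x2)" by simp
  then have s12: "s1 = s2" using s by simp
  then have h12: "height q1 = height q2" by (simp add: s1_def s2_def)
  have "cis x1 = cis x2" using e1 s12 s by simp
  then have "cis (x1 - x2) = 1" by (simp add: cis_divide[symmetric])
  then have "cos (x1 - x2) = 1" by (metis cis.sel(1) one_complex.sel(1))
  then obtain n :: int where n: "x1 - x2 = n * 2 * pi"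
    using cos_one_2pi_int[of "x1 - x2"] by auto
  have "spiral x1 - spiral x2 = snd q2 - snd q1" using e2 by (simp add: algebra_simps)
  then have "norm (spiral x1 - spiral x2) = norm (snd q2 - snd q1)" by simp
  also have "\<dots> < 2 * \<rho> x1 + 2 * \<rho> x2"
    using q norm_triangle_ineq4[of "snd q2" "snd q1"] by (simp add: tube_def x1_def x2_def)
  finally have lt: "norm (spiral x1 - spiral x2) < 2 * \<rho> x1 + 2 * \<rho> x2" .
  have "n = 0"
  proof (rule ccontr)
    assume "n \<noteq> 0"
    then consider "n \<ge> 1" | "n \<le> -1" by linarith
    then show False
    proof cases
      case 1
      then have "1 * (2 * pi) \<le> real_of_int n * (2 * pi)" by (intro mult_right_mono) auto
      then have "x2 + 2 * pi \<le> x1" using n by linarith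
      from spiral_separation[OF this] lt show False by (simp add: norm_minus_commute)
    next
      case 2
      then have "real_of_int n * (2 * pi) \<le> -1 * (2 * pi)" by (intro mult_right_mono) auto
      then have "x1 + 2 * pi \<le> x2" using n by linarith
      from spiral_separation[OF this] lt show False by simp
    qed
  qed
  then have x12: "x1 = x2" using n by simp
  with e2 have w: "snd q1 = snd q2" by simp
  with h12 x12 have "g (Im (fst q1)) = g (Im (fst q2))"
    by (simp add: height_def x1_def x2_def)
  then have v: "Im (fst q1) = Im (fst q2)"
    by (metis g_strict_mono less_irrefl linorder_neq_iff)
  with x12 have "Re (fst q1) = Re (fst q2)"
    using one_plus_square_pos[of "Im (fst q2)"] by (simp add: x1_def x2_def flat_def)
  with v w show "q1 = q2" by (simp add: prod_eq_iff complex_eq_iff)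
qed

text \<open>Along a fibre the height varies only through the shear, which is linear in
  \<open>w\<close> with slope at most \<open>Lip\<close>. Both square roots are at least 1, so
  taking roots does not enlarge the difference.\<close>

lemma fold_map_lipschitz:
  assumes "norm w \<le> 2" "norm w' \<le> 2"
  shows "dist (fold_map (z, w)) (fold_map (z, w')) \<le> (Lip + 1) * norm (w - w')"
proof -
  define a a' where "a = rim - height (z, w)" and "a' = rim - height (z, w')"
  have a: "1 \<le> a" "1 \<le> a'"
    using height_bound[of "(z, w)"] height_bound[of "(z, w')"] assms by (auto simp: a_def a'_def)
  have s: "1 \<le> sqrt (2 * a)" "1 \<le> sqrt (2 * a')" using a by auto
  have "a - a' = Im (spiral' (flat z) * cnj (w' - w))"
    by (simp add: a_def a'_def height_def algebra_simps)
  then have "\<bar>a - a'\<bar> \<le> norm (spiral' (flat z)) * norm (w' - w)"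
    using Im_mult_cnj_le by metis
  also have "\<dots> \<le> Lip * norm (w - w')"
    using norm_spiral' by (simp add: norm_minus_commute mult_right_mono)
  finally have aa: "\<bar>a - a'\<bar> \<le> Lip * norm (w - w')" .
  have "(sqrt (2 * a) - sqrt (2 * a')) * (sqrt (2 * a) + sqrt (2 * a')) = 2 * (a - a')"
    using a by (simp add: algebra_simps flip: power2_eq_square)
  then have "\<bar>sqrt (2 * a) - sqrt (2 * a')\<bar> * (sqrt (2 * a) + sqrt (2 * a')) = 2 * \<bar>a - a'\<bar>"
    using s by (metis abs_mult abs_of_nonneg abs_numeral add_nonneg_nonneg order_trans zero_le_one)
  moreover have "\<bar>sqrt (2 * a) - sqrt (2 * a')\<bar> * 2 \<le> \<bar>sqrt (2 * a) - sqrt (2 * a')\<bar> * (sqrt (2 * a) + sqrt (2 * a'))"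
    using add_mono[OF s] by (intro mult_left_mono) simp_all
  ultimately have "\<bar>sqrt (2 * a) - sqrt (2 * a')\<bar> * 2 \<le> 2 * \<bar>a - a'\<bar>" by (simp only:)
  then have ss: "\<bar>sqrt (2 * a) - sqrt (2 * a')\<bar> \<le> \<bar>a - a'\<bar>"
    unfolding mult.commute[of _ "2::real"] by (simp only: mult_le_cancel_left_pos zero_less_numeral)
  have "dist (fold_map (z, w)) (fold_map (z, w')) \<le>
     norm (sqrt (2 * a) *\<^sub>R cis (flat z) - sqrt (2 * a') *\<^sub>R cis (flat z)) + norm (w - w')"
    unfolding fold_map_def a_def a'_def by (simp add: dist_norm norm_Pair_le[THEN order_trans])
  also have "norm (sqrt (2 * a) *\<^sub>R cis (flat z) - sqrt (2 * a') *\<^sub>R cis (flat z)) = \<bar>sqrt (2 * a) - sqrt (2 * a')\<bar>"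
    by (simp flip: scaleR_diff_left)
  finally show ?thesis using ss aa by (simp add: algebra_simps)
qed

end

section \<open>The image of the domain\<close>

definition fibre_radius :: "real \<Rightarrow> complex \<Rightarrow> real" where
  "fibre_radius p z = (1 + pi * (cmod z)\<^sup>2) powr (- p / 2) / sqrt pi"

definition X_int :: "real \<Rightarrow> complex2 set" where
  "X_int p = {q. cmod (snd q) < fibre_radius p (fst q)}"

lemma one_plus_pi_pos: "0 < 1 + pi * (cmod z)\<^sup>2"
  by (intro add_pos_nonneg) auto

lemma fibre_radius_pos: "0 < fibre_radius p z"
  using one_plus_pi_pos[of z] by (simp add: fibre_radius_def)

lemma fibre_radius_square: "pi * (fibre_radius p z)\<^sup>2 = (1 + pi * (cmod z)\<^sup>2) powr (- p)"
proof -
  have "((1 + pi * (cmod z)\<^sup>2) powr (- p / 2))\<^sup>2 = (1 + pi * (cmod z)\<^sup>2) powr (- p)"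
    unfolding power2_eq_square[of "_ powr _"] powr_add[symmetric] by simp
  then show ?thesis by (simp add: fibre_radius_def power_divide)
qed

lemma continuous_on_fibre_radius: "continuous_on UNIV (fibre_radius p)"
  unfolding fibre_radius_def
  by (intro continuous_intros) (use one_plus_pi_pos in \<open>auto simp: less_imp_neq[symmetric]\<close>)

lemma continuous_on_fibre_radius_fst: "continuous_on UNIV (\<lambda>q::complex2. fibre_radius p (fst q))"
  by (rule continuous_on_compose2[OF continuous_on_fibre_radius]) (auto intro: continuous_intros)

lemma open_X_int: "open (X_int p)"
  unfolding X_int_def
  by (intro open_Collect_less continuous_intros continuous_on_fibre_radius_fst)

lemma X_eq: "X p = {q. cmod (snd q) \<le> fibre_radius p (fst q)}"
proof -
  have "pi * (cmod w)\<^sup>2 \<le> (1 + pi * (cmod z)\<^sup>2) powr (- p) \<longleftrightarrow> cmod w \<le> fibre_radius p z" for z w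
    unfolding fibre_radius_square[symmetric]
    using fibre_radius_pos[of p z] by (simp add: power2_le_iff_abs_le)
  then show ?thesis by (auto simp: X_def)
qed

text \<open>A point on the boundary circle of its fibre leaves \<open>X p\<close> under an
  arbitrarily small radial push.\<close>

lemma interior_X: "interior (X p) = X_int p"
proof
  show "X_int p \<subseteq> interior (X p)"
    by (rule interior_maximal[OF _ open_X_int]) (auto simp: X_eq X_int_def)
  show "interior (X p) \<subseteq> X_int p"
  proof
    fix q assume q: "q \<in> interior (X p)"
    obtain z w where zw: "q = (z, w)" by (cases q)
    obtain e where e: "e > 0" "ball q e \<subseteq> X p" using q mem_interior by blast
    have wX: "cmod w \<le> fibre_radius p z" using subsetD[OF interior_subset q] zw by (simp add: X_eq)
    show "q \<in> X_int p"
    proof (rule ccontr)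
      assume "q \<notin> X_int p"
      then have w: "cmod w = fibre_radius p z" using wX zw by (auto simp: X_int_def)
      then have w0: "cmod w > 0" using fibre_radius_pos[of p z] by simp
      define w' where "w' = (1 + e / 2 / cmod w) *\<^sub>R w"
      have "w' - w = (e / 2 / cmod w) *\<^sub>R w" by (simp add: w'_def algebra_simps)
      then have "norm (w' - w) = e / 2" using e(1) w0 by simp
      then have "dist q (z, w') < e" using e(1) by (simp add: zw dist_norm norm_minus_commute)
      then have "(z, w') \<in> X p" using e(2) by auto
      moreover have "cmod w' = cmod w + e / 2" using e(1) w0 by (simp add: w'_def distrib_right)
      ultimately show False using w e(1) by (simp add: X_eq)
    qed
  qed
qed

text \<open>The left side of the exponent condition is 1 at \<open>\<kappa> = 1 / 2\<close>, so
  every \<open>p > 1\<close> admits some \<open>\<kappa> > 1 / 2\<close>.\<close>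

locale folding_X = folding +
  fixes p :: real
  assumes p: "1 < p" and \<kappa>_p: "\<kappa> * (1 + 2 * \<kappa>) \<le> p"
begin

abbreviation "r \<equiv> fibre_radius p"

text \<open>With \<open>N = 1 + (cmod z)\<^sup>2\<close>, the squeezed coordinate satisfies
  \<open>1 + (flat z)\<^sup>2 \<le> N powr (1 + 2 * \<kappa>)\<close>, so
  \<open>\<rho> (flat z)\<close> decays at worst like
  \<open>N powr (- (\<kappa> * (1 + 2 * \<kappa>)) / 2)\<close>, which dominates
  \<open>N powr (- p / 2)\<close>.\<close>

lemma r_le_\<rho>: "r z \<le> \<rho> (flat z)"
proof -
  define N where "N = 1 + (cmod z)\<^sup>2"
  define B where "B = 1 + (Im z)\<^sup>2"
  have B: "1 \<le> B" "B \<le> N" by (auto simp: B_def N_def cmod_power2)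
  have "1 + (flat z)\<^sup>2 = 1 + (Re z)\<^sup>2 * B powr (2 * \<kappa>)"
    using B by (simp add: flat_def B_def[symmetric] power_mult_distrib powr_power mult.commute)
  also have "\<dots> \<le> N * B powr (2 * \<kappa>)"
  proof -
    have "1 \<le> B powr (2 * \<kappa>)" using B \<kappa> by (intro ge_one_powr_ge_zero) auto
    then have "1 + (Re z)\<^sup>2 * B powr (2 * \<kappa>) \<le> (1 + (Re z)\<^sup>2) * B powr (2 * \<kappa>)" by (simp add: algebra_simps)
    also have "\<dots> \<le> N * B powr (2 * \<kappa>)" by (intro mult_right_mono) (auto simp: N_def cmod_power2)
    finally show ?thesis .
  qed
  also have "\<dots> \<le> N * N powr (2 * \<kappa>)" using B \<kappa> by (intro mult_left_mono powr_mono2) auto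
  also have "\<dots> = N powr (1 + 2 * \<kappa>)" using B by (simp add: powr_add)
  finally have flat: "1 + (flat z)\<^sup>2 \<le> N powr (1 + 2 * \<kappa>)" .
  have "r z \<le> (1 + pi * (cmod z)\<^sup>2) powr (- p / 2)"
    using pi_gt3 by (simp add: fibre_radius_def divide_le_eq mult_le_cancel_left1)
  also have "\<dots> \<le> N powr (- p / 2)"
    using p B pi_gt3 mult_right_mono[of 1 pi "(cmod z)\<^sup>2"] by (intro powr_mono2') (auto simp: N_def)
  also have "\<dots> \<le> N powr (- (\<kappa> * (1 + 2 * \<kappa>)) / 2)"
    using B \<kappa>_p by (intro powr_mono) auto
  also have "\<dots> = (N powr (1 + 2 * \<kappa>)) powr (- \<kappa> / 2)" by (simp add: powr_powr mult.commute)
  also have "\<dots> \<le> \<rho> (flat z)"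
    unfolding decay_def using flat \<kappa> one_plus_square_pos by (intro powr_mono2') auto
  finally show ?thesis .
qed

lemma r_le_1: "r z \<le> 1"
  using r_le_\<rho> \<rho>_le_1 by (rule order_trans)

lemma X_int_subset_tube: "X_int p \<subseteq> tube"
proof
  fix q assume "q \<in> X_int p"
  then show "q \<in> tube"
    using r_le_\<rho>[of "fst q"] \<rho>_pos[of "flat (fst q)"] by (simp add: X_int_def tube_def)
qed

section \<open>The fibre radius in the squeezed coordinates\<close>

definition unflat :: "real \<Rightarrow> real \<Rightarrow> complex" where
  "unflat x v = Complex (x * (1 + v\<^sup>2) powr (- \<kappa>)) v"

lemma flat_unflat [simp]: "flat (unflat x v) = x"
  using one_plus_square_pos[of v] by (simp add: flat_def unflat_def powr_minus)

lemma unflat_flat [simp]: "unflat (flat z) (Im z) = z"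
  using one_plus_square_pos[of "Im z"] by (simp add: flat_def unflat_def powr_minus complex_eq_iff)

text \<open>The product of \<open>p / 2\<close>, from the power rule, and \<open>6 * pi\<close>,
  from the estimate of \<open>N'\<close> in the vertical direction.\<close>

definition "Lip_r = 3 * p * pi"

lemma Lip_r_pos: "0 < Lip_r" using p by (simp add: Lip_r_def)

lemma r_unflat_lipschitz: "\<bar>r (unflat x v) - r (unflat x' v)\<bar> \<le> Lip_r * \<bar>x - x'\<bar>"
proof -
  define f where "f u = (1 + pi * (u\<^sup>2 + v\<^sup>2)) powr (- p / 2) / sqrt pi" for u
  define f' where "f' u = (- p / 2) * (1 + pi * (u\<^sup>2 + v\<^sup>2)) powr (- p / 2 - 1) * (pi * (2 * u)) / sqrt pi" for u
  have pos: "1 \<le> 1 + pi * (u\<^sup>2 + v\<^sup>2)" for u by auto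
  have f: "(f has_real_derivative f' u) (at u)" for u
  proof -
    have "((\<lambda>u. 1 + pi * (u\<^sup>2 + v\<^sup>2)) has_real_derivative pi * (2 * u)) (at u)"
      by (auto intro!: derivative_eq_intros)
    from DERIV_cdivide[OF DERIV_chain2[OF has_real_derivative_powr this, of "- p / 2"], of "sqrt pi"] pos[of u]
    show ?thesis unfolding f_def f'_def by simp
  qed
  have f': "\<bar>f' u\<bar> \<le> Lip_r" for u
  proof -
    let ?N = "1 + pi * (u\<^sup>2 + v\<^sup>2)"
    have "\<bar>u\<bar> \<le> 1 + u\<^sup>2" using zero_le_power2[of "\<bar>u\<bar> - 1"] by (simp add: power2_diff)
    also have "\<dots> \<le> ?N"
      using mult_mono[of 1 pi "u\<^sup>2" "u\<^sup>2 + v\<^sup>2"] pi_gt3 by simp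
    finally have "?N powr (- p / 2 - 1) * \<bar>u\<bar> \<le> ?N powr (- p / 2 - 1) * ?N"
      by (intro mult_left_mono) auto
    also have "\<dots> = ?N powr (- p / 2)" using pos[of u] by (simp add: powr_diff)
    also have "\<dots> \<le> ?N powr 0" using pos[of u] p by (intro powr_mono) auto
    also have "\<dots> = 1" using pos[of u] by (metis not_one_le_zero powr_zero_eq_one)
    finally have "\<bar>f' u\<bar> \<le> p * pi * 1 / sqrt pi"
      using p by (simp add: f'_def abs_mult divide_right_mono mult_left_mono mult.assoc)
    also have "\<dots> \<le> Lip_r"
    proof -
      have "1 \<le> 3 * sqrt pi" using real_sqrt_ge_one[of pi] pi_gt3 by linarith
      then show ?thesis using p by (simp add: Lip_r_def divide_le_eq mult_le_cancel_left1)
    qed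
    finally show ?thesis .
  qed
  define b where "b = (1 + v\<^sup>2) powr (- \<kappa>)"
  have b: "0 \<le> b" "b \<le> 1"
    using powr_mono[of "- \<kappa>" 0 "1 + v\<^sup>2"] \<kappa> one_plus_square_pos[of v] by (auto simp: b_def)
  have "\<bar>f (x * b) - f (x' * b)\<bar> \<le> Lip_r * \<bar>x * b - x' * b\<bar>"
    using field_differentiable_bound[of UNIV f f' Lip_r "x * b" "x' * b"] f f' by simp
  also have "\<dots> \<le> Lip_r * \<bar>x - x'\<bar>"
  proof -
    have "\<bar>x * b - x' * b\<bar> = \<bar>x - x'\<bar> * b" using b by (simp add: abs_mult flip: left_diff_distrib)
    also have "\<dots> \<le> \<bar>x - x'\<bar>" using b by (simp add: mult_left_le)
    finally show ?thesis using Lip_r_pos by simp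
  qed
  finally show ?thesis
    by (simp add: f_def fibre_radius_def unflat_def b_def cmod_power2)
qed

text \<open>The density \<open>(\<rho> v)\<^sup>2\<close> of \<open>g\<close> decays slowly enough for this bound: the fibre radius stays
  Lipschitz in the squeezed coordinate \<open>g v\<close>.\<close>

lemma r_unflat_deriv:
  obtains f' where "\<And>v. ((\<lambda>v. r (unflat x v)) has_real_derivative f' v) (at v)"
    "\<And>v. \<bar>f' v\<bar> \<le> Lip_r * (\<rho> v)\<^sup>2"
proof -
  define u where "u v = x * (1 + v\<^sup>2) powr (- \<kappa>)" for v :: real
  define N where "N v = 1 + pi * ((u v)\<^sup>2 + v\<^sup>2)" for v :: real
  define N' where "N' v = pi * (2 * v - 4 * \<kappa> * v * (u v)\<^sup>2 / (1 + v\<^sup>2))" for v :: real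
  define f' where "f' v = (- p / 2) * N v powr (- p / 2 - 1) * N' v / sqrt pi" for v
  have N1: "1 \<le> N v" for v by (auto simp: N_def)
  have u: "(u has_real_derivative (- (2 * \<kappa>) * v * u v / (1 + v\<^sup>2))) (at v)" for v
    unfolding u_def using one_plus_square_pos[of v]
    by (auto intro!: derivative_eq_intros simp: powr_diff field_simps)
  have N: "(N has_real_derivative N' v) (at v)" for v
    unfolding N_def N'_def
    by (auto intro!: derivative_eq_intros u simp: algebra_simps power2_eq_square)
  have der: "((\<lambda>v. r (unflat x v)) has_real_derivative f' v) (at v)" for v
  proof -
    have "((\<lambda>v. N v powr (- p / 2) / sqrt pi) has_real_derivative f' v) (at v)"
      using DERIV_cdivide[OF DERIV_chain2[OF has_real_derivative_powr N, of v "- p / 2"], of "sqrt pi"] N1[of v]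
      unfolding f'_def by simp
    then show ?thesis by (simp add: N_def u_def fibre_radius_def unflat_def cmod_power2)
  qed
  have bound: "\<bar>f' v\<bar> \<le> Lip_r * (\<rho> v)\<^sup>2" for v
  proof -
    define B where "B = 1 + v\<^sup>2"
    have B: "1 \<le> B" by (simp add: B_def)
    have uN: "(u v)\<^sup>2 \<le> N v" "B \<le> N v"
      using mult_right_mono[of 1 pi "(u v)\<^sup>2 + v\<^sup>2"] pi_gt3 unfolding N_def B_def
      by (smt (verit) zero_le_power2)+
    have v: "\<bar>v\<bar> \<le> B powr (1 / 2)" by (simp add: B_def powr_half_sqrt real_le_rsqrt)
    have N'_le: "\<bar>N' v\<bar> \<le> pi * (2 * \<bar>v\<bar> + 4 * \<bar>v\<bar> * ((u v)\<^sup>2 / B))"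
    proof -
      have "\<bar>2 * v - 4 * \<kappa> * v * (u v)\<^sup>2 / B\<bar> \<le> \<bar>2 * v\<bar> + \<bar>4 * \<kappa> * v * (u v)\<^sup>2 / B\<bar>"
        by (rule abs_triangle_ineq4)
      also have "\<bar>4 * \<kappa> * v * (u v)\<^sup>2 / B\<bar> = \<kappa> * (4 * \<bar>v\<bar> * ((u v)\<^sup>2 / B))"
        using \<kappa> B by (simp add: abs_mult)
      also have "\<dots> \<le> 1 * (4 * \<bar>v\<bar> * ((u v)\<^sup>2 / B))"
        using \<kappa> B by (intro mult_right_mono) auto
      finally show ?thesis by (simp add: N'_def B_def[symmetric] abs_mult)
    qed
    \<comment> \<open>Both terms in the bound for \<open>N'\<close>, weighted by
      \<open>B powr \<kappa>\<close>, are controlled by the same power of \<open>N v\<close>, since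
      \<open>\<bar>v\<bar>\<close> is at most the root of \<open>B\<close> and both \<open>B\<close>
      and \<open>(u v)\<^sup>2\<close> are at most \<open>N v\<close>.\<close>
    have "\<bar>v\<bar> * B powr \<kappa> \<le> N v powr (\<kappa> + 1 / 2)"
    proof -
      have "\<bar>v\<bar> * B powr \<kappa> \<le> B powr (1 / 2) * B powr \<kappa>" by (intro mult_right_mono v) auto
      also have "\<dots> = B powr (\<kappa> + 1 / 2)" by (simp add: powr_add mult.commute)
      also have "\<dots> \<le> N v powr (\<kappa> + 1 / 2)" using B uN \<kappa> by (intro powr_mono2) auto
      finally show ?thesis .
    qed
    moreover have "\<bar>v\<bar> * ((u v)\<^sup>2 / B) * B powr \<kappa> \<le> N v powr (\<kappa> + 1 / 2)"
    proof -
      have "\<bar>v\<bar> * ((u v)\<^sup>2 / B) * B powr \<kappa> = (\<bar>v\<bar> * B powr (\<kappa> - 1)) * (u v)\<^sup>2"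
        using B by (simp add: powr_diff)
      also have "\<dots> \<le> (B powr (1 / 2) * B powr (\<kappa> - 1)) * N v"
        using N1[of v] by (intro mult_mono v uN) auto
      also have "B powr (1 / 2) * B powr (\<kappa> - 1) = B powr (\<kappa> - 1 / 2)"
        by (simp add: powr_add[symmetric])
      also have "B powr (\<kappa> - 1 / 2) * N v \<le> N v powr (\<kappa> - 1 / 2) * N v powr 1"
        using B uN \<kappa> N1[of v] by (intro mult_mono powr_mono2) auto
      also have "\<dots> = N v powr (\<kappa> + 1 / 2)" by (simp only: powr_add[symmetric]) (simp add: add.commute)
      finally show ?thesis .
    qed
    ultimately have "(2 * \<bar>v\<bar> + 4 * \<bar>v\<bar> * ((u v)\<^sup>2 / B)) * B powr \<kappa> \<le> 6 * N v powr (\<kappa> + 1 / 2)"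
      by (simp add: distrib_right)
    then have "pi * ((2 * \<bar>v\<bar> + 4 * \<bar>v\<bar> * ((u v)\<^sup>2 / B)) * B powr \<kappa>) \<le> pi * (6 * N v powr (\<kappa> + 1 / 2))"
      by (intro mult_left_mono) auto
    then have "\<bar>N' v\<bar> * B powr \<kappa> \<le> 6 * pi * N v powr (\<kappa> + 1 / 2)"
      using mult_right_mono[OF N'_le, of "B powr \<kappa>"] by (simp add: algebra_simps)
    \<comment> \<open>The exponent is raised to the one that cancels
      \<open>N v powr (- p / 2 - 1)\<close> from the power rule.\<close>
    also have "\<dots> \<le> 6 * pi * N v powr (p / 2 + 1)"
      using N1[of v] \<kappa> p by (intro mult_left_mono powr_mono) auto
    finally have "\<bar>N' v\<bar> * B powr \<kappa> \<le> 6 * pi * N v powr (p / 2 + 1)" .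
    then have "(p / 2 * N v powr (- p / 2 - 1)) * (\<bar>N' v\<bar> * B powr \<kappa>)
        \<le> (p / 2 * N v powr (- p / 2 - 1)) * (6 * pi * N v powr (p / 2 + 1))"
      using p by (intro mult_left_mono) auto
    also have "\<dots> = 3 * p * pi * N v powr ((- p / 2 - 1) + (p / 2 + 1))"
      by (simp only: powr_add) simp
    also have "\<dots> = Lip_r" using N1[of v] by (simp add: Lip_r_def)
    finally have 1: "(p / 2 * N v powr (- p / 2 - 1)) * (\<bar>N' v\<bar> * B powr \<kappa>) \<le> Lip_r" .
    have "\<bar>f' v\<bar> * B powr \<kappa> = (p / 2 * N v powr (- p / 2 - 1)) * (\<bar>N' v\<bar> * B powr \<kappa>) / sqrt pi"
      using p by (simp add: f'_def abs_mult)
    also have "\<dots> \<le> Lip_r / sqrt pi" using 1 by (intro divide_right_mono) auto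
    also have "\<dots> \<le> Lip_r"
      using Lip_r_pos pi_gt3 by (simp add: divide_le_eq mult_le_cancel_left1)
    finally have "\<bar>f' v\<bar> \<le> Lip_r / B powr \<kappa>" using B by (simp add: le_divide_eq)
    also have "\<dots> = Lip_r * (\<rho> v)\<^sup>2" using B by (simp add: \<rho>_square B_def powr_minus divide_inverse)
    finally show ?thesis .
  qed
  show ?thesis using that[OF der bound] .
qed

text \<open>Uniformly in \<open>x\<close>, the fibres shrink to points towards both ends of the
  strip; \<open>unflat_shift\<close> uses this to find far points with small fibres.\<close>

lemma r_unflat_tail:
  assumes "0 < \<bar>v\<bar>" shows "r (unflat x v) \<le> 1 / \<bar>v\<bar>"
proof -
  have v2: "0 < v\<^sup>2" using assms by simp
  define N where "N = 1 + pi * (cmod (unflat x v))\<^sup>2"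
  have le: "v\<^sup>2 \<le> (cmod (unflat x v))\<^sup>2" by (simp add: unflat_def cmod_power2)
  also have "\<dots> \<le> pi * (cmod (unflat x v))\<^sup>2"
    using mult_right_mono[of 1 pi "(cmod (unflat x v))\<^sup>2"] pi_gt3 by simp
  finally have N: "v\<^sup>2 \<le> N" "1 \<le> N" by (auto simp: N_def)
  have "r (unflat x v) \<le> N powr (- p / 2)"
    using pi_gt3 by (simp add: fibre_radius_def N_def divide_le_eq mult_le_cancel_left1)
  also have "\<dots> \<le> N powr (- 1 / 2)" using N p by (intro powr_mono) auto
  also have "\<dots> \<le> (v\<^sup>2) powr (- 1 / 2)" using N v2 by (intro powr_mono2') auto
  also have "\<dots> = 1 / \<bar>v\<bar>" using v2 by (simp add: powr_minus_divide powr_half_sqrt flip: minus_divide_left)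
  finally show ?thesis .
qed

text \<open>The range of \<open>g\<close> is bounded, so it must be shown that \<open>y\<close> is
  attained. The fibre radius loses at most \<open>Lip_r\<close> times the change of \<open>g\<close>
  and tends to 0 at the ends, so \<open>g\<close> has at least \<open>r (unflat x v) / Lip_r\<close>
  left to travel in either direction. The same monotonicity bounds the radius at
  \<open>v'\<close>.\<close>

lemma unflat_shift:
  assumes lt: "Lip_r * \<bar>y - g v\<bar> < r (unflat x v)"
  obtains v' where "g v' = y" "r (unflat x v) - Lip_r * \<bar>y - g v\<bar> \<le> r (unflat x v')"
proof -
  let ?s = "\<lambda>v. r (unflat x v)"
  obtain f' where f': "\<And>v. (?s has_real_derivative f' v) (at v)" "\<And>v. \<bar>f' v\<bar> \<le> Lip_r * (\<rho> v)\<^sup>2"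
    by (rule r_unflat_deriv[of x]) (rule that)
  have up: "?s a + Lip_r * g a \<le> ?s b + Lip_r * g b" if "a \<le> b" for a b
  proof (rule nondecreasing_of_deriv[OF that])
    show "((\<lambda>t. ?s t + Lip_r * g t) has_real_derivative (f' t + Lip_r * (\<rho> t)\<^sup>2)) (at t)" for t
      by (intro DERIV_add f' DERIV_cmult g_deriv)
    show "0 \<le> f' t + Lip_r * (\<rho> t)\<^sup>2" for t using f'(2)[of t] by linarith
  qed
  have dn: "Lip_r * g a - ?s a \<le> Lip_r * g b - ?s b" if "a \<le> b" for a b
  proof (rule nondecreasing_of_deriv[OF that])
    show "((\<lambda>t. Lip_r * g t - ?s t) has_real_derivative (Lip_r * (\<rho> t)\<^sup>2 - f' t)) (at t)" for t
      by (intro DERIV_diff f' DERIV_cmult g_deriv)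
    show "0 \<le> Lip_r * (\<rho> t)\<^sup>2 - f' t" for t using f'(2)[of t] by linarith
  qed
  define \<delta> where "\<delta> = ?s v - Lip_r * \<bar>y - g v\<bar>"
  have \<delta>: "\<delta> > 0" using lt by (simp add: \<delta>_def)
  \<comment> \<open>Beyond \<open>1 / \<delta>\<close>, so that the fibres at \<open>T\<close> and
    \<open>- T\<close> have radius below \<open>\<delta>\<close>, and large enough for
    \<open>v\<close> to lie between these points.\<close>
  define T where "T = 1 / \<delta> + 1 + \<bar>v\<bar>"
  have T: "T > 1 / \<delta>" "T > 0" "- T \<le> v" "v \<le> T"
  proof -
    have "0 < 1 / \<delta>" using \<delta> by simp
    then show "T > 1 / \<delta>" "T > 0" "- T \<le> v" "v \<le> T" unfolding T_def by linarith+
  qed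
  have "1 / T < \<delta>" using T \<delta> by (simp add: field_simps)
  then have sT: "?s T < \<delta>" "?s (- T) < \<delta>"
    using r_unflat_tail[of T x] r_unflat_tail[of "- T" x] T(2) by auto
  have cont: "isCont g t" for t using g_deriv DERIV_isCont by blast
  show ?thesis
  proof (cases "g v \<le> y")
    case True
    then have \<delta>_eq: "\<delta> = ?s v - Lip_r * y + Lip_r * g v" by (simp add: \<delta>_def algebra_simps)
    have "Lip_r * y < Lip_r * g T" using up[OF T(4)] sT \<delta>_eq by linarith
    then have "y \<le> g T" using Lip_r_pos by simp
    then obtain v' where "v \<le> v'" "v' \<le> T" "g v' = y"
      using IVT[of g v y T] True T(4) cont by blast
    then show ?thesis using that[of v'] up[of v v'] \<delta>_eq by (simp add: \<delta>_def)
  next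
    case False
    then have \<delta>_eq: "\<delta> = ?s v - Lip_r * g v + Lip_r * y" by (simp add: \<delta>_def algebra_simps)
    have "Lip_r * g (- T) < Lip_r * y" using dn[OF T(3)] sT \<delta>_eq by linarith
    then have "g (- T) \<le> y" using Lip_r_pos by simp
    then obtain v' where "- T \<le> v'" "v' \<le> v" "g v' = y"
      using IVT[of g "- T" y v] False T(3) cont by auto
    then show ?thesis using that[of v'] dn[of v' v] \<delta>_eq by (simp add: \<delta>_def)
  qed
qed

section \<open>Balls contained in the image\<close>

lemma polar_perturbation:
  assumes s: "1 \<le> s" and d: "norm (Z - s *\<^sub>R cis x) \<le> d" "d < 1 / 2"
  obtains x' where "Z = norm Z *\<^sub>R cis x'" "\<bar>x' - x\<bar> \<le> 2 * d"
proof -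
  define a where "a = s *\<^sub>R cis x"
  have a: "a \<noteq> 0" "norm a = s" using s by (auto simp: a_def)
  \<comment> \<open>The relative perturbation. Its norm is at most \<open>d < 1 / 2\<close>, so the
    imaginary part of the principal logarithm of \<open>1 + \<eta>\<close> is an angle of size at
    most \<open>2 * d\<close>; adding it to \<open>x\<close> selects the argument of
    \<open>Z\<close> near \<open>x\<close>.\<close>
  define \<eta> where "\<eta> = Z / a - 1"
  have "\<eta> = (Z - a) / a" using a by (simp add: \<eta>_def diff_divide_distrib)
  then have "norm \<eta> = norm (Z - a) / s" using a by (simp add: norm_divide)
  also have "\<dots> \<le> norm (Z - a)" using s by (simp add: divide_le_eq mult_le_cancel_left1)
  finally have \<eta>: "norm \<eta> \<le> d" using d(1) by (simp add: a_def)
  have nz: "1 + \<eta> \<noteq> 0"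
  proof
    assume "1 + \<eta> = 0"
    then have "\<eta> = - 1" by (simp add: add_eq_0_iff)
    then show False using \<eta> d(2) by simp
  qed
  define \<theta> where "\<theta> = Im (Ln (1 + \<eta>))"
  have nz: "1 + \<eta> \<noteq> 0"
    using \<eta> d(2) by (metis add.commute add_eq_0_iff norm_minus_cancel norm_one not_le order_trans less_imp_le
        half_gt_zero_iff zero_less_one less_le_trans field_less_half_sum one_add_one field_sum_of_halves le_less_trans less_irrefl add_less_same_cancel1)
  have "\<bar>\<theta>\<bar> \<le> norm (Ln (1 + \<eta>))" unfolding \<theta>_def by (rule abs_Im_le_cmod)
  also have "\<dots> \<le> 2 * norm \<eta>" using \<eta> d(2) by (intro norm_Ln_le) linarith
  finally have \<theta>: "\<bar>\<theta>\<bar> \<le> 2 * d" using \<eta> by linarith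
  have \<eta>_polar: "1 + \<eta> = norm (1 + \<eta>) *\<^sub>R cis \<theta>"
    using rcis_cmod_Arg[of "1 + \<eta>"] Arg_eq_Im_Ln[OF nz] by (simp add: \<theta>_def rcis_def scaleR_conv_of_real)
  have "Z = a * (1 + \<eta>)" using a by (simp add: \<eta>_def)
  also have "\<dots> = a * (norm (1 + \<eta>) *\<^sub>R cis \<theta>)" using \<eta>_polar by simp
  also have "\<dots> = (s * norm (1 + \<eta>)) *\<^sub>R cis (x + \<theta>)" by (simp add: a_def cis_mult[symmetric])
  finally have "Z = (s * norm (1 + \<eta>)) *\<^sub>R cis (x + \<theta>)" .
  moreover from this have "norm Z = s * norm (1 + \<eta>)" using s by (simp add: abs_mult)
  ultimately show ?thesis using that[of "x + \<theta>"] \<theta> by simp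
qed

text \<open>Change of \<open>y\<close> per unit of \<open>d\<close>: \<open>2 * rim + 1\<close> from
  the radius in \<open>stage3\<close>, then the shear, through \<open>w\<close> with
  \<open>Lip * (1 + 2 * Lip)\<close> and through \<open>x\<close> with
  \<open>2 * Lip\<close>.\<close>

definition "height_const = 2 * rim + 1 + Lip * (1 + 2 * Lip) + 2 * Lip"

text \<open>Loss of distance to the fibre boundary per unit of \<open>d\<close>: the radius changes
  with \<open>x\<close> and with \<open>y\<close>, and \<open>w\<close> itself moves by
  \<open>1 + 2 * Lip\<close>.\<close>

definition "collar_const = 2 * Lip_r + Lip_r * height_const + 1 + 2 * Lip"

lemma rim_ge_1: "1 \<le> rim"
  using M_nonneg Lip_pos by (simp add: rim_def)

lemma height_const_pos: "0 < height_const"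
  using rim_ge_1 Lip_pos by (simp add: height_const_def add_pos_pos)

lemma collar_const_pos: "0 < collar_const"
  using Lip_r_pos Lip_pos height_const_pos by (simp add: collar_const_def add_pos_pos)

text \<open>The folding map is inverted on the ball one coordinate at a time: \<open>x'\<close> from
  the polar angle, then \<open>w'\<close>, then the required value \<open>y\<close> of
  \<open>g\<close>, and \<open>v'\<close> by \<open>unflat_shift\<close>. The losses add up to
  \<open>collar_const * d\<close>.\<close>

lemma ball_subset_image:
  assumes d: "0 < d" "d < 1 / 2" and w: "norm w < r z - collar_const * d"
  shows "ball (fold_map (z, w)) d \<subseteq> fold_map ` X_int p"
proof
  fix P assume "P \<in> ball (fold_map (z, w)) d"
  then have dist: "dist P (fold_map (z, w)) < d" by (simp add: dist_commute)
  define x where "x = flat z"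
  define v where "v = Im z"
  define h where "h = height (z, w)"
  define s where "s = sqrt (2 * (rim - h))"
  define s' where "s' = norm (fst P)"
  have z: "unflat x v = z" by (simp add: x_def v_def)
  have "norm w \<le> 1"
    using w r_le_1[of z] mult_pos_pos[OF collar_const_pos d(1)] by linarith
  have h: "h \<le> rim - 1" using height_bound[of "(z, w)"] \<open>norm w \<le> 1\<close> by (simp add: h_def)
  have h_low: "- rim \<le> h"
  proof -
    have "\<bar>Im (spiral' x * cnj w)\<bar> \<le> norm (spiral' x) * norm w" by (rule Im_mult_cnj_le)
    also have "\<dots> \<le> Lip * 1" using norm_spiral' \<open>norm w \<le> 1\<close> Lip_pos by (intro mult_mono) auto
    finally show ?thesis
      using g_bound[of v] Lip_pos by (simp add: h_def height_def rim_def x_def v_def)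
  qed
  have s2: "s\<^sup>2 = 2 * (rim - h)" using h by (simp add: s_def)
  have s: "1 \<le> s" using h by (simp add: s_def)
  have s_up: "s \<le> 2 * rim"
  proof (rule power2_le_imp_le)
    have "s\<^sup>2 \<le> 4 * rim" using s2 h_low by simp
    also have "\<dots> \<le> 4 * (rim * rim)" using rim_ge_1 by simp
    finally show "s\<^sup>2 \<le> (2 * rim)\<^sup>2" by (simp add: power2_eq_square)
  qed (use rim_ge_1 in simp)
  have fst_d: "norm (fst P - s *\<^sub>R cis x) \<le> d"
    using dist_fst_le[of P "fold_map (z, w)"] dist
    by (simp add: fold_map_def s_def h_def x_def dist_norm)
  have snd_d: "norm (snd P - (w + spiral x)) \<le> d"
    using dist_snd_le[of P "fold_map (z, w)"] dist by (simp add: fold_map_def x_def dist_norm)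
  obtain x' where x': "fst P = s' *\<^sub>R cis x'" "\<bar>x' - x\<bar> \<le> 2 * d"
    using polar_perturbation[OF s fst_d d(2)] unfolding s'_def by metis
  have ss': "\<bar>s - s'\<bar> \<le> d"
  proof -
    have "\<bar>norm (fst P) - norm (s *\<^sub>R cis x)\<bar> \<le> d"
      using norm_triangle_ineq3 fst_d by (rule order_trans)
    then show ?thesis using s by (simp add: s'_def)
  qed
  define h' where "h' = rim - s'\<^sup>2 / 2"
  have hh': "\<bar>h' - h\<bar> \<le> (2 * rim + 1) * d"
  proof -
    have "h' - h = (s - s') * ((s + s') / 2)"
      using s2 by (simp add: h'_def algebra_simps power2_eq_square)
    then have "\<bar>h' - h\<bar> = \<bar>s - s'\<bar> * \<bar>(s + s') / 2\<bar>" by (simp only: abs_mult)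
    also have "\<dots> \<le> d * (2 * rim + 1)"
      using ss' s_up s d by (intro mult_mono) auto
    finally show ?thesis by (simp add: mult.commute)
  qed
  define w' where "w' = snd P - spiral x'"
  have sp: "norm (spiral x' - spiral x) \<le> Lip * (2 * d)" "norm (spiral' x' - spiral' x) \<le> Lip * (2 * d)"
    using spiral_lipschitz[of x' x] spiral'_lipschitz[of x' x] mult_left_mono[OF x'(2), of Lip] Lip_pos
    by linarith+
  have ww': "norm (w' - w) \<le> (1 + 2 * Lip) * d"
  proof -
    have "w' - w = (snd P - (w + spiral x)) - (spiral x' - spiral x)" by (simp add: w'_def)
    then have "norm (w' - w) \<le> norm (snd P - (w + spiral x)) + norm (spiral x' - spiral x)"
      by (simp only: norm_triangle_ineq4)
    then show ?thesis using snd_d sp by (simp add: algebra_simps)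
  qed
  have shear: "\<bar>Im (spiral' x' * cnj w') - Im (spiral' x * cnj w)\<bar> \<le> Lip * ((1 + 2 * Lip) * d) + Lip * (2 * d)"
  proof -
    have "Im (spiral' x' * cnj w') - Im (spiral' x * cnj w)
        = Im (spiral' x' * cnj (w' - w)) + Im ((spiral' x' - spiral' x) * cnj w)"
      by (simp add: algebra_simps)
    also have "\<bar>\<dots>\<bar> \<le> norm (spiral' x') * norm (w' - w) + norm (spiral' x' - spiral' x) * norm w"
      by (intro order_trans[OF abs_triangle_ineq] add_mono Im_mult_cnj_le)
    also have "\<dots> \<le> Lip * ((1 + 2 * Lip) * d) + Lip * (2 * d) * 1"
      using norm_spiral' ww' sp(2) \<open>norm w \<le> 1\<close> Lip_pos d by (intro add_mono mult_mono) auto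
    finally show ?thesis by simp
  qed
  define y where "y = h' - Im (spiral' x' * cnj w')"
  have "y - g v = (h' - h) - (Im (spiral' x' * cnj w') - Im (spiral' x * cnj w))"
    by (simp add: y_def h_def height_def x_def v_def)
  then have "\<bar>y - g v\<bar> \<le> \<bar>h' - h\<bar> + \<bar>Im (spiral' x' * cnj w') - Im (spiral' x * cnj w)\<bar>"
    by (simp only: abs_triangle_ineq4)
  also have "\<dots> \<le> height_const * d"
    using hh' shear by (simp add: height_const_def algebra_simps)
  finally have "Lip_r * \<bar>y - g v\<bar> \<le> Lip_r * (height_const * d)"
    using Lip_r_pos by (intro mult_left_mono) auto
  moreover have "r z - Lip_r * (2 * d) \<le> r (unflat x' v)"
    using r_unflat_lipschitz[of x' v x] mult_left_mono[OF x'(2), of Lip_r] Lip_r_pos unfolding z by linarith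
  moreover have cc: "collar_const * d = Lip_r * (2 * d) + Lip_r * (height_const * d) + (1 + 2 * Lip) * d"
    by (simp add: collar_const_def algebra_simps)
  moreover have "norm w' \<le> norm w + (1 + 2 * Lip) * d"
    using norm_triangle_sub[of w' w] ww' by linarith
  ultimately have w'_lt: "norm w' < r (unflat x' v) - Lip_r * \<bar>y - g v\<bar>"
    using w by linarith
  then have "Lip_r * \<bar>y - g v\<bar> < r (unflat x' v)" using norm_ge_zero[of w'] by linarith
  then obtain v' where v': "g v' = y" "r (unflat x' v) - Lip_r * \<bar>y - g v\<bar> \<le> r (unflat x' v')"
    by (rule unflat_shift) (rule that)
  have "(unflat x' v', w') \<in> X_int p" using w'_lt v'(2) by (simp add: X_int_def)
  moreover have "fold_map (unflat x' v', w') = P"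
  proof -
    have "height (unflat x' v', w') = g v' + Im (spiral' x' * cnj w')"
      unfolding height_def fst_conv snd_conv flat_unflat by (simp add: unflat_def)
    then have "height (unflat x' v', w') = h'" by (simp add: v'(1) y_def)
    then have "sqrt (2 * (rim - height (unflat x' v', w'))) = s'"
      by (simp add: h'_def s'_def)
    then show ?thesis
      unfolding fold_map_def fst_conv snd_conv flat_unflat
      by (simp add: w'_def x'(1)[symmetric])
  qed
  ultimately show "P \<in> fold_map ` X_int p" by (metis imageI)
qed

section \<open>Points of the tube outside the domain\<close>

definition outer :: "complex2 set" where
  "outer = tube \<inter> {q. r (fst q) < norm (snd q)}"

lemma open_outer_image: "open (fold_map ` outer)"
proof (rule invariance_of_domain)
  show "open outer"
    unfolding outer_def
    by (intro open_Int open_tube open_Collect_less continuous_intros continuous_on_fibre_radius_fst)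
  show "continuous_on outer fold_map"
    using symplectic_fold_map unfolding symplectic_on_def outer_def
    by (auto intro: continuous_on_subset[OF smooth_on_imp_continuous_on])
  show "inj_on fold_map outer"
    by (rule inj_on_subset[OF inj_on_fold_map]) (auto simp: outer_def)
qed

lemma outer_disjoint: "fold_map ` outer \<inter> fold_map ` X_int p = {}"
proof -
  have "outer \<inter> X_int p = {}" by (auto simp: outer_def X_int_def)
  then show ?thesis
    using inj_on_image_Int[OF inj_on_fold_map, of outer "X_int p"] X_int_subset_tube
    by (auto simp: outer_def)
qed

text \<open>Moving \<open>w\<close> radially just past the edge of its fibre stays in the tube,
  where \<open>fold_map_lipschitz\<close> controls the displacement and injectivity keeps the new
  image off the image of the domain.\<close>

lemma exit_point:
  assumes q: "(z, w) \<in> X_int p" and \<delta>: "\<delta> > 0"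
  obtains Q where "Q \<in> fold_map ` outer" "dist (fold_map (z, w)) Q \<le> (Lip + 1) * (r z - norm w + \<delta>)"
proof -
  \<comment> \<open>The cap by \<open>\<rho> (flat z) / 2\<close> keeps
    \<open>r z + \<epsilon>\<close> below the tube radius
    \<open>2 * \<rho> (flat z)\<close>.\<close>
  define \<epsilon> where "\<epsilon> = min \<delta> (\<rho> (flat z) / 2)"
  have \<epsilon>: "0 < \<epsilon>" "\<epsilon> \<le> \<delta>" "\<epsilon> < \<rho> (flat z)" using \<delta> \<rho>_pos[of "flat z"] by (auto simp: \<epsilon>_def)
  obtain e :: complex where e: "norm e = 1" "w = norm w *\<^sub>R e"
  proof (cases "w = 0")
    case True
    then show ?thesis using that[of 1] by simp
  next
    case False
    then show ?thesis using that[of "w /\<^sub>R norm w"] by simp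
  qed
  define w' where "w' = (r z + \<epsilon>) *\<^sub>R e"
  have w': "norm w' = r z + \<epsilon>" using e(1) \<epsilon>(1) fibre_radius_pos[of p z] by (simp add: w'_def)
  have w: "norm w < r z" using q by (simp add: X_int_def)
  have "w - w' = (norm w - (r z + \<epsilon>)) *\<^sub>R e"
    by (subst e(2)) (simp add: w'_def algebra_simps)
  then have ww': "norm (w - w') = r z - norm w + \<epsilon>" using e(1) w \<epsilon>(1) by simp
  have out: "(z, w') \<in> outer"
    using w' \<epsilon> r_le_\<rho>[of z] by (simp add: outer_def tube_def)
  have "norm w' \<le> 2" using out tube_norm_le[of "(z, w')"] by (simp add: outer_def)
  moreover have "norm w \<le> 2" using w r_le_1[of z] by linarith
  ultimately have "dist (fold_map (z, w)) (fold_map (z, w')) \<le> (Lip + 1) * norm (w - w')"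
    by (intro fold_map_lipschitz)
  also have "\<dots> \<le> (Lip + 1) * (r z - norm w + \<delta>)"
    unfolding ww' using \<epsilon> Lip_pos by (intro mult_left_mono) auto
  finally show ?thesis using that[of "fold_map (z, w')"] out by blast
qed

lemma open_image: "open (fold_map ` X_int p)"
proof (rule invariance_of_domain[OF _ open_X_int])
  show "continuous_on (X_int p) fold_map"
    using symplectic_fold_map X_int_subset_tube unfolding symplectic_on_def
    by (auto intro: continuous_on_subset[OF smooth_on_imp_continuous_on])
  show "inj_on fold_map (X_int p)"
    by (rule inj_on_subset[OF inj_on_fold_map X_int_subset_tube])
qed

lemma bounded_image: "bounded (fold_map ` X_int p)"
proof (rule boundedI)
  fix P assume "P \<in> fold_map ` X_int p"
  then obtain z w where q: "(z, w) \<in> X_int p" "P = fold_map (z, w)" by auto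
  have w: "norm w \<le> 1" using q r_le_1[of z] by (simp add: X_int_def)
  have "- rim \<le> height (z, w)"
  proof -
    have "\<bar>Im (spiral' (flat z) * cnj w)\<bar> \<le> norm (spiral' (flat z)) * norm w" by (rule Im_mult_cnj_le)
    also have "\<dots> \<le> Lip * 1" using norm_spiral' w Lip_pos by (intro mult_mono) auto
    finally show ?thesis
      using g_bound[of "Im z"] Lip_pos by (simp add: height_def rim_def)
  qed
  moreover have "height (z, w) \<le> rim" using height_bound[of "(z, w)"] w by simp
  ultimately have "norm (fst P) \<le> sqrt (4 * rim)" by (simp add: q(2) fold_map_def)
  moreover have "norm (snd P) \<le> 1 + (16 * M + 8)"
    using norm_triangle_mono[OF w norm_spiral] by (simp add: q(2) fold_map_def)
  ultimately show "norm P \<le> sqrt (4 * rim) + (1 + (16 * M + 8))"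
    using norm_Pair_le[of "fst P" "snd P"] by simp
qed

lemma interior_closure_image: "interior (closure (fold_map ` X_int p)) = fold_map ` X_int p"
  (is "interior (closure ?U) = ?U")
proof
  show "?U \<subseteq> interior (closure ?U)"
    by (rule interior_maximal[OF closure_subset open_image])
  show "interior (closure ?U) \<subseteq> ?U"
  proof (rule ccontr)
    assume "\<not> interior (closure ?U) \<subseteq> ?U"
    then obtain P where P: "P \<in> interior (closure ?U)" "P \<notin> ?U" by blast
    then obtain e where e: "e > 0" "ball P e \<subseteq> closure ?U" using mem_interior by blast
    \<comment> \<open>Chosen so that the step from \<open>P\<close> to \<open>P'\<close> followed by
      the exit to \<open>Q\<close> stays within \<open>e\<close>, and so that
      \<open>ball_subset_image\<close> applies.\<close>
    define d where "d = min (1 / 4) (e / (2 * (1 + (Lip + 1) * (collar_const + 1))))"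
    have pos: "0 < 1 + (Lip + 1) * (collar_const + 1)"
      using Lip_pos collar_const_pos by (intro add_pos_pos mult_pos_pos) auto
    have d: "0 < d" "d < 1 / 2" "d * (1 + (Lip + 1) * (collar_const + 1)) < e"
    proof -
      show "0 < d" using e(1) pos by (simp add: d_def)
      show "d < 1 / 2" by (simp add: d_def)
      have "d \<le> e / (2 * (1 + (Lip + 1) * (collar_const + 1)))" by (simp add: d_def)
      then have "d * (1 + (Lip + 1) * (collar_const + 1)) \<le> e / 2" using pos by (simp add: field_simps)
      then show "d * (1 + (Lip + 1) * (collar_const + 1)) < e" using e(1) by simp
    qed
    have "P \<in> closure ?U" using P(1) interior_subset by blast
    then obtain P' where P': "P' \<in> ?U" "dist P' P < d" using d(1) closure_approachable by metis
    then obtain z w where q: "(z, w) \<in> X_int p" "P' = fold_map (z, w)" by auto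
    have "\<not> norm w < r z - collar_const * d"
    proof
      assume "norm w < r z - collar_const * d"
      from ball_subset_image[OF d(1,2) this] P' P(2) q(2) show False by (auto simp: dist_commute)
    qed
    then have "r z - norm w + d \<le> (collar_const + 1) * d" by (simp add: algebra_simps)
    moreover obtain Q where Q: "Q \<in> fold_map ` outer" "dist P' Q \<le> (Lip + 1) * (r z - norm w + d)"
      using exit_point[OF q(1) d(1)] q(2) by blast
    ultimately have "dist P' Q \<le> (Lip + 1) * ((collar_const + 1) * d)"
      using Lip_pos by (smt (verit) mult_left_mono)
    then have "dist P Q < e"
      using dist_triangle[of P Q P'] P'(2) d(3) by (simp add: dist_commute algebra_simps)
    then have "Q \<in> closure ?U" using e(2) by auto
    then have "fold_map ` outer \<inter> ?U \<noteq> {}"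
      using Q(1) open_outer_image open_Int_closure_eq_empty by blast
    then show False using outer_disjoint by blast
  qed
qed

end

section \<open>Volumes\<close>

lemma borel_measurable_decay [measurable]: "decay \<kappa> \<in> borel_measurable borel"
  using smooth_on_imp_continuous_on[OF smooth_on_decay] by (rule borel_measurable_continuous_onI)

text \<open>By the fundamental theorem the integral over each symmetric interval is a difference of
  two values of a bounded antiderivative; monotone convergence passes to the line.\<close>

lemma nn_integral_decay_square_finite:
  assumes \<kappa>: "1 / 2 < \<kappa>"
  shows "(\<integral>\<^sup>+t. ennreal ((decay \<kappa> t)\<^sup>2) \<partial>lborel) < \<infinity>"
proof -
  have "continuous_on UNIV (\<lambda>t. (decay \<kappa> t)\<^sup>2)"
    by (intro continuous_intros smooth_on_imp_continuous_on[OF smooth_on_decay])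
  then obtain F where F: "\<forall>t. (F has_real_derivative (decay \<kappa> t)\<^sup>2) (at t)"
    using antiderivative_exists by blast
  then obtain M where M: "\<And>t. \<bar>F t\<bar> \<le> M"
    using bounded_antiderivative[OF \<kappa>, of F] by metis
  let ?f = "\<lambda>(n::nat) t. ennreal ((decay \<kappa> t)\<^sup>2) * indicator {- real n..real n} t"
  have "(SUP n. ?f n t) = ennreal ((decay \<kappa> t)\<^sup>2)" for t
  proof (rule antisym)
    show "(SUP n. ?f n t) \<le> ennreal ((decay \<kappa> t)\<^sup>2)"
      by (intro SUP_least) (simp split: split_indicator)
    obtain n :: nat where "\<bar>t\<bar> \<le> real n" using real_arch_simple by blast
    then have "t \<in> {- real n..real n}" by (simp add: abs_le_iff)
    then have "ennreal ((decay \<kappa> t)\<^sup>2) = ?f n t" by simp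
    also have "\<dots> \<le> (SUP n. ?f n t)" by (rule SUP_upper) simp
    finally show "ennreal ((decay \<kappa> t)\<^sup>2) \<le> (SUP n. ?f n t)" .
  qed
  then have "(\<integral>\<^sup>+t. ennreal ((decay \<kappa> t)\<^sup>2) \<partial>lborel) = (\<integral>\<^sup>+t. (SUP n. ?f n t) \<partial>lborel)" by simp
  also have "\<dots> = (SUP n. \<integral>\<^sup>+t. ?f n t \<partial>lborel)"
    by (rule nn_integral_monotone_convergence_SUP)
      (auto simp: incseq_def le_fun_def split: split_indicator)
  also have "\<dots> \<le> ennreal (2 * M)"
  proof (rule SUP_least)
    fix n :: nat
    have "(\<integral>\<^sup>+t. ?f n t \<partial>lborel) = ennreal (F n - F (- real n))"
      by (rule nn_integral_FTC_Icc) (use F in auto)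
    also have "\<dots> \<le> ennreal (2 * M)"
      using M[of "real n"] M[of "- real n"] by (intro ennreal_leI) linarith
    finally show "(\<integral>\<^sup>+t. ?f n t \<partial>lborel) \<le> ennreal (2 * M)" .
  qed
  finally show ?thesis by (rule le_less_trans) simp
qed

lemma nn_integral_complex_prod:
  fixes h :: "real \<Rightarrow> ennreal"
  assumes [measurable]: "h \<in> borel_measurable borel"
  shows "(\<integral>\<^sup>+z. h (Re z) * h (Im z) \<partial>lborel) = (\<integral>\<^sup>+t. h t \<partial>lborel)\<^sup>2"
proof -
  have "(\<integral>\<^sup>+z. (\<Prod>b\<in>Basis. h (z \<bullet> b)) \<partial>(lborel :: complex measure)) = (\<Prod>b\<in>(Basis :: complex set). \<integral>\<^sup>+t. h t \<partial>lborel)"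
    by (rule nn_integral_lborel_prod) auto
  then show ?thesis by (simp add: Basis_complex_def power2_eq_square complex_eq_iff)
qed

lemma sqrt_pi_ge_1: "1 \<le> sqrt pi" using pi_gt3 by simp

lemma fibre_radius_le:
  assumes "0 < p" shows "fibre_radius p z \<le> (1 + (cmod z)\<^sup>2) powr (- p / 2)"
proof -
  have "fibre_radius p z \<le> (1 + pi * (cmod z)\<^sup>2) powr (- p / 2)"
    using sqrt_pi_ge_1 by (simp add: fibre_radius_def divide_le_eq mult_le_cancel_left1)
  also have "\<dots> \<le> (1 + (cmod z)\<^sup>2) powr (- p / 2)"
    using assms pi_gt3 mult_right_mono[of 1 pi "(cmod z)\<^sup>2"] by (intro powr_mono2') (auto intro: add_pos_nonneg)
  finally show ?thesis .
qed

text \<open>Replaces a radial integrand by a product of functions of the two coordinates, so that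
  its integral over the plane is bounded by the square of a one-dimensional one. The 4 arises
  because the product of the two factors is only bounded by the square of
  \<open>1 + (cmod z)\<^sup>2\<close>.\<close>

lemma fibre_radius_powr_le:
  assumes "0 < p" "0 \<le> a"
  shows "fibre_radius p z powr a \<le> (decay (p * a / 4) (Re z))\<^sup>2 * (decay (p * a / 4) (Im z))\<^sup>2"
proof -
  define N where "N = 1 + (cmod z)\<^sup>2"
  have N: "1 \<le> N" by (simp add: N_def)
  have "(1 + (Re z)\<^sup>2) * (1 + (Im z)\<^sup>2) \<le> N * N"
    by (intro mult_mono) (auto simp: N_def cmod_power2)
  then have le: "(1 + (Re z)\<^sup>2) * (1 + (Im z)\<^sup>2) \<le> N powr 2" using N by (simp add: power2_eq_square)
  have "fibre_radius p z powr a \<le> (N powr (- p / 2)) powr a"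
    using fibre_radius_le[OF assms(1)] assms(2) less_imp_le[OF fibre_radius_pos] unfolding N_def
    by (intro powr_mono2) auto
  also have "\<dots> = (N powr 2) powr (- (p * a / 4))" by (simp add: powr_powr mult.commute)
  also have "\<dots> \<le> ((1 + (Re z)\<^sup>2) * (1 + (Im z)\<^sup>2)) powr (- (p * a / 4))"
    using le assms one_plus_square_pos by (intro powr_mono2') auto
  also have "\<dots> = (decay (p * a / 4) (Re z))\<^sup>2 * (decay (p * a / 4) (Im z))\<^sup>2"
    by (simp add: decay_square powr_mult less_imp_le[OF one_plus_square_pos])
  finally show ?thesis .
qed

lemma unit_ball_vol_2: "unit_ball_vol 2 = pi"
  using unit_ball_vol_even[of 1] by simp

lemma emeasure_disc: "0 \<le> b \<Longrightarrow> emeasure lborel (ball (c::complex) b) = ennreal (pi * b\<^sup>2)"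
  by (simp add: emeasure_ball unit_ball_vol_2)

text \<open>For \<open>b \<le> a\<close> the disc area trades \<open>b powr (1 - \<tau>)\<close> for
  \<open>a powr (1 - \<tau>)\<close>; for \<open>a < b\<close> the annulus bound trades
  \<open>a powr \<tau>\<close> for \<open>b powr \<tau>\<close>.\<close>

lemma emeasure_fibre_collar:
  assumes b: "0 < b" and a: "0 < a" and \<tau>: "0 \<le> \<tau>" "\<tau> \<le> 1"
  shows "emeasure lborel {w::complex. cmod w < b \<and> b - a \<le> cmod w} \<le> ennreal (2 * pi * a powr (1 - \<tau>) * b powr (1 + \<tau>))"
proof (cases "b \<le> a")
  case True
  have "{w. cmod w < b \<and> b - a \<le> cmod w} \<subseteq> ball 0 b" by auto
  then have "emeasure lborel {w. cmod w < b \<and> b - a \<le> cmod w} \<le> emeasure lborel (ball (0::complex) b)"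
    by (intro emeasure_mono) auto
  also have "\<dots> = ennreal (pi * b\<^sup>2)" using b by (simp add: emeasure_disc)
  also have "\<dots> \<le> ennreal (2 * pi * a powr (1 - \<tau>) * b powr (1 + \<tau>))"
  proof (rule ennreal_leI)
    have "pi * b\<^sup>2 = pi * (b powr (1 - \<tau>) * b powr (1 + \<tau>))"
      using b by (simp add: powr_add[symmetric])
    also have "\<dots> \<le> (2 * pi) * (a powr (1 - \<tau>) * b powr (1 + \<tau>))"
      using b True \<tau> by (intro mult_mono powr_mono2) auto
    finally show "pi * b\<^sup>2 \<le> 2 * pi * a powr (1 - \<tau>) * b powr (1 + \<tau>)" by (simp add: mult.assoc)
  qed
  finally show ?thesis .
next
  case False
  have eq: "{w. cmod w < b \<and> b - a \<le> cmod w} = ball 0 b - ball 0 (b - a)" by auto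
  have "emeasure lborel (ball (0::complex) b - ball 0 (b - a)) =
      emeasure lborel (ball (0::complex) b) - emeasure lborel (ball (0::complex) (b - a))"
    using a False by (intro emeasure_Diff) (auto simp: emeasure_disc)
  also have "\<dots> = ennreal (pi * b\<^sup>2 - pi * (b - a)\<^sup>2)"
    using a b False by (simp add: emeasure_disc ennreal_minus)
  also have "\<dots> \<le> ennreal (2 * pi * a powr (1 - \<tau>) * b powr (1 + \<tau>))"
  proof (rule ennreal_leI)
    have "pi * b\<^sup>2 - pi * (b - a)\<^sup>2 = pi * (2 * a * b) - pi * a\<^sup>2" by (simp add: power2_eq_square algebra_simps)
    also have "\<dots> \<le> 2 * pi * (a * b)" by simp
    also have "\<dots> = 2 * pi * ((a powr (1 - \<tau>) * a powr \<tau>) * b)"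
      using a by (simp add: powr_add[symmetric])
    also have "\<dots> \<le> 2 * pi * ((a powr (1 - \<tau>) * b powr \<tau>) * b)"
      using a b False \<tau> by (intro mult_left_mono mult_right_mono powr_mono2) auto
    also have "\<dots> = 2 * pi * a powr (1 - \<tau>) * b powr (1 + \<tau>)"
      using b by (simp add: powr_add)
    finally show "pi * b\<^sup>2 - pi * (b - a)\<^sup>2 \<le> 2 * pi * a powr (1 - \<tau>) * b powr (1 + \<tau>)" .
  qed
  finally show ?thesis by (simp add: eq)
qed

lemma emeasure_complex2:
  fixes A :: "complex2 set"
  assumes "A \<in> sets borel"
  shows "emeasure lborel A = (\<integral>\<^sup>+z. emeasure lborel {w. (z, w) \<in> A} \<partial>(lborel :: complex measure))"
proof -
  have "A \<in> sets (lborel \<Otimes>\<^sub>M (lborel :: complex measure))" unfolding lborel_prod using assms by simp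
  from lborel.emeasure_pair_measure_alt[OF this] show ?thesis
    by (simp add: lborel_prod vimage_def)
qed

lemma collar_sets [measurable]:
  "{q \<in> X_int p. fibre_radius p (fst q) - a \<le> cmod (snd q)} \<in> sets borel"
proof -
  have "closed {q::complex2. fibre_radius p (fst q) - a \<le> cmod (snd q)}"
    by (intro closed_Collect_le continuous_intros continuous_on_fibre_radius_fst)
  then have "X_int p \<inter> {q::complex2. fibre_radius p (fst q) - a \<le> cmod (snd q)} \<in> sets borel"
    by (intro sets.Int borel_open[OF open_X_int] borel_closed)
  then show ?thesis by (simp add: Collect_conj_eq)
qed

text \<open>Interpolating with exponent \<open>\<tau>\<close> between the two bounds \<open>\<pi> r\<^sup>2\<close> and \<open>2 \<pi> a r\<close> for the
  area of an annulus of outer radius \<open>r\<close> and width at most \<open>a\<close> makes the integral over all fibres converge.\<close>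

lemma emeasure_collar:
  assumes p: "1 < p" and \<tau>: "0 \<le> \<tau>" "\<tau> \<le> 1" "2 / p - 1 < \<tau>"
  obtains C where "0 \<le> C" "\<And>a. 0 < a \<Longrightarrow>
    emeasure lborel {q \<in> X_int p. fibre_radius p (fst q) - a \<le> cmod (snd q)} \<le> ennreal (C * a powr (1 - \<tau>))"
proof -
  \<comment> \<open>The decay exponent that \<open>fibre_radius_powr_le\<close> gives for the power
    \<open>1 + \<tau>\<close>; the condition \<open>2 / p - 1 < \<tau>\<close> says exactly that it
    exceeds 1/2.\<close>
  define k where "k = p * (1 + \<tau>) / 4"
  have k: "1 / 2 < k" using \<tau> p by (simp add: k_def field_simps)
  define I where "I = (\<integral>\<^sup>+t. ennreal ((decay k t)\<^sup>2) \<partial>lborel)"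
  have I: "I < \<infinity>" unfolding I_def by (rule nn_integral_decay_square_finite[OF k])
  define C where "C = 2 * pi * enn2real (I\<^sup>2)"
  have I2: "I\<^sup>2 = ennreal (enn2real (I\<^sup>2))"
    using I by (simp add: ennreal_enn2real_if power2_eq_square ennreal_mult_eq_top_iff less_top[symmetric])
  show ?thesis
  proof (rule that[of C])
    show "0 \<le> C" by (simp add: C_def)
    fix a :: real assume a: "0 < a"
    let ?A = "{q \<in> X_int p. fibre_radius p (fst q) - a \<le> cmod (snd q)}"
    let ?c = "2 * pi * a powr (1 - \<tau>)"
    have "emeasure lborel ?A = (\<integral>\<^sup>+z. emeasure lborel {w. (z, w) \<in> ?A} \<partial>lborel)"
      by (rule emeasure_complex2) measurable
    also have "\<dots> \<le> (\<integral>\<^sup>+z. ennreal ?c * (ennreal ((decay k (Re z))\<^sup>2) * ennreal ((decay k (Im z))\<^sup>2)) \<partial>lborel)"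
    proof (rule nn_integral_mono)
      fix z :: complex
      have "{w. (z, w) \<in> ?A} = {w. cmod w < fibre_radius p z \<and> fibre_radius p z - a \<le> cmod w}"
        by (auto simp: X_int_def)
      then have "emeasure lborel {w. (z, w) \<in> ?A} \<le> ennreal (?c * fibre_radius p z powr (1 + \<tau>))"
        using emeasure_fibre_collar[OF fibre_radius_pos a \<tau>(1,2)] by simp
      also have "\<dots> \<le> ennreal (?c * ((decay k (Re z))\<^sup>2 * (decay k (Im z))\<^sup>2))"
        using fibre_radius_powr_le[of p "1 + \<tau>" z] p \<tau> unfolding k_def
        by (intro ennreal_leI mult_left_mono) auto
      also have "\<dots> = ennreal ?c * (ennreal ((decay k (Re z))\<^sup>2) * ennreal ((decay k (Im z))\<^sup>2))"
        by (simp add: ennreal_mult)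
      finally show "emeasure lborel {w. (z, w) \<in> ?A} \<le>
        ennreal ?c * (ennreal ((decay k (Re z))\<^sup>2) * ennreal ((decay k (Im z))\<^sup>2))" .
    qed
    also have "\<dots> = ennreal ?c * (\<integral>\<^sup>+z. ennreal ((decay k (Re z))\<^sup>2) * ennreal ((decay k (Im z))\<^sup>2) \<partial>lborel)"
      by (rule nn_integral_cmult) measurable
    also have "\<dots> = ennreal ?c * I\<^sup>2"
      unfolding I_def by (subst nn_integral_complex_prod[symmetric]) auto
    also have "\<dots> = ennreal (C * a powr (1 - \<tau>))"
      unfolding C_def by (subst I2) (simp add: ennreal_mult[symmetric] algebra_simps)
    finally show "emeasure lborel ?A \<le> ennreal (C * a powr (1 - \<tau>))" .
  qed
qed

text \<open>All fibres have radius at most 1, so the fibre collar of width 1 is the whole domain;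
  \<open>\<tau> = 1\<close> is admissible for every \<open>p > 1\<close>.\<close>

lemma emeasure_X_int_finite:
  assumes p: "1 < p" shows "emeasure lborel (X_int p) < \<infinity>"
proof -
  have "2 / p - 1 < 1" using p by (simp add: field_simps)
  then obtain C where "\<And>a. 0 < a \<Longrightarrow>
      emeasure lborel {q \<in> X_int p. fibre_radius p (fst q) - a \<le> cmod (snd q)} \<le> ennreal (C * a powr (1 - 1))"
    by (rule emeasure_collar[OF p zero_le_one order_refl]) (rule that)
  from this[of 1]
  have "emeasure lborel {q \<in> X_int p. fibre_radius p (fst q) - 1 \<le> cmod (snd q)} \<le> ennreal C" by simp
  moreover have "fibre_radius p z \<le> 1" for z
  proof -
    have "fibre_radius p z \<le> (1 + (cmod z)\<^sup>2) powr (- p / 2)" using p by (intro fibre_radius_le) simp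
    also have "\<dots> \<le> (1 + (cmod z)\<^sup>2) powr 0" using p by (intro powr_mono) auto
    also have "\<dots> = 1" using one_plus_square_pos[of "cmod z"] by simp
    finally show ?thesis .
  qed
  then have "{q \<in> X_int p. fibre_radius p (fst q) - 1 \<le> cmod (snd q)} = X_int p"
    by (auto intro: order_trans[OF _ norm_ge_zero])
  ultimately show ?thesis by (auto intro: le_less_trans)
qed

text \<open>For \<open>z\<close> in the annulus where \<open>pi * (cmod z)\<^sup>2\<close> lies
  between \<open>A\<close> and \<open>2 * A\<close>, the fibre radius is below \<open>b\<close> but
  at least \<open>\<sigma>\<close>, a fixed multiple of \<open>b\<close>; the 3 comes from
  \<open>1 + 2 * A < 3 * A\<close>. The annulus has area \<open>A = b powr (- 2 / p)\<close> and the
  discs have area of order \<open>b\<^sup>2\<close>.\<close>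

lemma emeasure_thin_part:
  assumes p: "1 < p" and b: "0 < b" "b < 1"
  shows "ennreal (3 powr (- p) * b powr (2 - 2 / p)) \<le> emeasure lborel {q \<in> X_int p. fibre_radius p (fst q) < b}"
proof -
  define A where "A = b powr (- 2 / p)"
  have A: "1 < A" using b p powr_less_mono2_neg[of "- 2 / p" b 1] by (simp add: A_def)
  have Ab: "A powr (- p / 2) = b" using b p by (simp add: A_def powr_powr)
  define S where "S = ball (0::complex) (sqrt (2 * A / pi)) - cball 0 (sqrt (A / pi))"
  define \<sigma> where "\<sigma> = 3 powr (- p / 2) * b / sqrt pi"
  have \<sigma>: "0 < \<sigma>" using b by (simp add: \<sigma>_def)
  have S: "A < pi * (cmod z)\<^sup>2" "pi * (cmod z)\<^sup>2 < 2 * A" if "z \<in> S" for z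
  proof -
    have z: "sqrt (A / pi) < cmod z" "cmod z < sqrt (2 * A / pi)" using that by (auto simp: S_def)
    have "(sqrt (A / pi))\<^sup>2 < (cmod z)\<^sup>2" using z(1) A by (intro power_strict_mono) auto
    then show "A < pi * (cmod z)\<^sup>2" using A by (simp add: field_simps)
    have "(cmod z)\<^sup>2 < (sqrt (2 * A / pi))\<^sup>2" using z(2) by (intro power_strict_mono) auto
    then show "pi * (cmod z)\<^sup>2 < 2 * A" using A by (simp add: field_simps)
  qed
  have sub: "S \<times> ball 0 \<sigma> \<subseteq> {q \<in> X_int p. fibre_radius p (fst q) < b}"
  proof clarify
    fix z w :: complex assume z: "z \<in> S" and w: "w \<in> ball 0 \<sigma>"
    have "\<sigma> = (3 * A) powr (- p / 2) / sqrt pi"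
      using A unfolding \<sigma>_def by (subst powr_mult) (simp_all only: Ab)
    also have "\<dots> \<le> fibre_radius p z"
      unfolding fibre_radius_def using S[OF z] A p
      by (intro divide_right_mono powr_mono2') (auto intro: add_pos_nonneg)
    finally have 1: "\<sigma> \<le> fibre_radius p z" .
    have "fibre_radius p z \<le> (1 + pi * (cmod z)\<^sup>2) powr (- p / 2)"
      using sqrt_pi_ge_1 by (simp add: fibre_radius_def divide_le_eq mult_le_cancel_left1)
    also have "\<dots> < A powr (- p / 2)"
      using S[OF z] A p by (intro powr_less_mono2_neg) auto
    finally have "fibre_radius p z < b" by (simp only: Ab)
    with 1 w show "(z, w) \<in> X_int p \<and> fibre_radius p (fst (z, w)) < b" by (simp add: X_int_def)
  qed
  have "emeasure lborel S = ennreal (pi * (sqrt (2 * A / pi))\<^sup>2) - ennreal (pi * (sqrt (A / pi))\<^sup>2)"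
  proof -
    have "cball (0::complex) (sqrt (A / pi)) \<subseteq> ball 0 (sqrt (2 * A / pi))"
    proof -
      have "sqrt (A / pi) < sqrt (2 * A / pi)" using A by (simp add: divide_strict_right_mono)
      then show ?thesis unfolding subset_iff mem_cball mem_ball by (meson le_less_trans)
    qed
    then have "emeasure lborel S = emeasure lborel (ball (0::complex) (sqrt (2 * A / pi))) - emeasure lborel (cball (0::complex) (sqrt (A / pi)))"
      unfolding S_def using A by (intro emeasure_Diff) (auto simp: emeasure_cball)
    then show ?thesis using A by (simp add: emeasure_ball emeasure_cball unit_ball_vol_2)
  qed
  also have "\<dots> = ennreal A" using A by (simp add: ennreal_minus)
  finally have eS: "emeasure lborel S = ennreal A" .
  have "ennreal (3 powr (- p) * b powr (2 - 2 / p)) = ennreal (A * (pi * \<sigma>\<^sup>2))"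
  proof -
    have "pi * \<sigma>\<^sup>2 = (3 powr (- p / 2))\<^sup>2 * b\<^sup>2" by (simp add: \<sigma>_def power_mult_distrib power_divide)
    also have "(3 powr (- p / 2))\<^sup>2 = 3 powr (- p)"
      unfolding power2_eq_square[of "_ powr _"] powr_add[symmetric] by simp
    also have "b\<^sup>2 = b powr 2" using b by simp
    finally have "A * (pi * \<sigma>\<^sup>2) = 3 powr (- p) * (b powr (- 2 / p) * b powr 2)" by (simp add: A_def)
    also have "b powr (- 2 / p) * b powr 2 = b powr (2 - 2 / p)" by (simp add: powr_add[symmetric])
    finally show ?thesis by simp
  qed
  also have "\<dots> = emeasure lborel S * emeasure lborel (ball (0::complex) \<sigma>)"
    using A \<sigma> by (simp add: eS emeasure_disc ennreal_mult)
  also have "\<dots> = emeasure (lborel \<Otimes>\<^sub>M lborel) (S \<times> ball (0::complex) \<sigma>)"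
    by (intro lborel.emeasure_pair_measure_Times[symmetric]) (auto simp: S_def)
  also have "\<dots> = emeasure lborel (S \<times> ball (0::complex) \<sigma>)" by (simp add: lborel_prod)
  also have "\<dots> \<le> emeasure lborel {q \<in> X_int p. fibre_radius p (fst q) < b}"
  proof (rule emeasure_mono[OF sub])
    have "open {q::complex2. fibre_radius p (fst q) < b}"
      by (intro open_Collect_less continuous_intros continuous_on_fibre_radius_fst)
    then have "open {q \<in> X_int p. fibre_radius p (fst q) < b}"
      using open_X_int by (simp add: Collect_conj_eq open_Int)
    then show "{q \<in> X_int p. fibre_radius p (fst q) < b} \<in> sets lborel" by simp
  qed
  finally show ?thesis .
qed

section \<open>Collar volume and dimension of the image\<close>

context folding_X
begin

lemma open_collar_preimage:
  "open {q \<in> X_int p. infdist (fold_map q) (frontier (fold_map ` X_int p)) < d}"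
proof -
  have cont: "continuous_on (X_int p) fold_map"
    using symplectic_on_subset[OF symplectic_fold_map X_int_subset_tube] smooth_on_imp_continuous_on
    unfolding symplectic_on_def by blast
  have "continuous_on (X_int p) (\<lambda>q. infdist (fold_map q) (frontier (fold_map ` X_int p)))"
    by (intro continuous_on_infdist cont)
  from continuous_open_preimage[OF this open_X_int open_lessThan[of d]] show ?thesis
    by (simp add: vimage_def Int_def)
qed

lemma inner_collar_volume_image:
  "inner_collar_volume (fold_map ` X_int p) d =
     measure lborel {q \<in> X_int p. infdist (fold_map q) (frontier (fold_map ` X_int p)) < d}"
  (is "inner_collar_volume ?U d = measure lborel ?A")
proof -
  have fin: "emeasure lborel ?A < \<infinity>"
    by (rule le_less_trans[OF emeasure_mono emeasure_X_int_finite[OF p]]) (auto simp: open_X_int)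
  have "?A \<subseteq> tube" using X_int_subset_tube by blast
  then have "symplectic_on ?A fold_map" by (rule symplectic_on_subset[OF symplectic_fold_map])
  then have "emeasure lborel (fold_map ` ?A) = emeasure lborel ?A"
    unfolding symplectic_on_def
    by (intro emeasure_symplectic_image[OF open_collar_preimage inj_on_subset[OF inj_on_fold_map \<open>?A \<subseteq> tube\<close>] fin
          smooth_on_imp_has_derivative]) blast+
  moreover have "{x \<in> ?U. infdist x (frontier ?U) < d} = fold_map ` ?A" by auto
  ultimately show ?thesis by (simp add: inner_collar_volume_def measure_def)
qed

lemma image_nonempty: "fold_map ` X_int p \<noteq> {}"
  using fibre_radius_pos[of p 0] by (auto simp: X_int_def intro!: exI[of _ 0])

text \<open>An image point within \<open>d\<close> of the frontier has no \<open>d\<close>-ball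
  inside the image, so by \<open>ball_subset_image\<close> it comes from the fibre collar of width
  \<open>collar_const * d\<close>.\<close>

lemma collar_upper:
  assumes \<sigma>: "0 < \<sigma>" "\<sigma> < min 1 (2 - 2 / p)"
  shows "\<exists>C d1. d1 > 0 \<and> (\<forall>d. 0 < d \<longrightarrow> d < d1 \<longrightarrow>
    inner_collar_volume (fold_map ` X_int p) d \<le> C * d powr \<sigma>)"
proof -
  let ?U = "fold_map ` X_int p"
  \<comment> \<open>The interpolation exponent is \<open>1 - \<sigma>\<close>; the requirement for
    convergence becomes \<open>\<sigma> < 2 - 2 / p\<close>.\<close>
  have "0 \<le> 1 - \<sigma>" "1 - \<sigma> \<le> 1" "2 / p - 1 < 1 - \<sigma>" using \<sigma> by auto
  then obtain C where C: "0 \<le> C" "\<And>a. 0 < a \<Longrightarrow>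
    emeasure lborel {q \<in> X_int p. r (fst q) - a \<le> cmod (snd q)} \<le> ennreal (C * a powr (1 - (1 - \<sigma>)))"
    by (rule emeasure_collar[OF p]) (rule that)
  have "inner_collar_volume ?U d \<le> (C * collar_const powr \<sigma>) * d powr \<sigma>" if d: "0 < d" "d < 1 / 2" for d
  proof -
    let ?A = "{q \<in> X_int p. infdist (fold_map q) (frontier ?U) < d}"
    let ?B = "{q \<in> X_int p. r (fst q) - collar_const * d \<le> cmod (snd q)}"
    have "?A \<subseteq> ?B"
    proof
      fix q assume "q \<in> ?A"
      obtain z w where zw: "q = (z, w)" by (cases q)
      have q: "(z, w) \<in> X_int p" "infdist (fold_map (z, w)) (frontier ?U) < d"
        using \<open>q \<in> ?A\<close> by (simp_all add: zw)
      have "\<not> norm w < r z - collar_const * d"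
      proof
        assume "norm w < r z - collar_const * d"
        from infdist_frontier_ge[OF open_image bounded_image ball_subset_image[OF d this] imageI[OF q(1)]]
        show False using q(2) by simp
      qed
      then show "q \<in> ?B" using q(1) by (simp add: zw)
    qed
    then have "emeasure lborel ?A \<le> emeasure lborel ?B" by (rule emeasure_mono) simp
    also have "\<dots> \<le> ennreal (C * (collar_const * d) powr (1 - (1 - \<sigma>)))"
      using C(2) collar_const_pos d by simp
    also have "\<dots> = ennreal ((C * collar_const powr \<sigma>) * d powr \<sigma>)"
      using collar_const_pos d by (simp add: powr_mult mult.assoc)
    finally show ?thesis
      unfolding inner_collar_volume_image measure_def using C(1)
      by (intro enn2real_leI) auto
  qed
  then show ?thesis by (intro exI[of _ "C * collar_const powr \<sigma>"] exI[of _ "1 / 2"]) auto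
qed

text \<open>For \<open>p \<ge> 2\<close> the linear bound valid for every bounded open set suffices.
  For \<open>p < 2\<close> the fibres of radius below a multiple of \<open>d\<close> lie entirely in
  the collar, and their total volume is larger.\<close>

lemma collar_lower:
  obtains c d0 where "0 < c" "0 < d0" "\<And>d. 0 < d \<Longrightarrow> d < d0 \<Longrightarrow>
    c * d powr (min 1 (2 - 2 / p)) \<le> inner_collar_volume (fold_map ` X_int p) d"
proof (cases "2 - 2 / p < 1")
  case False
  obtain c where "c > 0" "\<And>d. 0 < d \<Longrightarrow> d < 1 \<Longrightarrow> c * d \<le> inner_collar_volume (fold_map ` X_int p) d"
    using inner_collar_volume_linear_lower_bound[OF open_image bounded_image image_nonempty] by blast
  then show ?thesis using False by (intro that[of c 1]) (auto simp: min_def)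
next
  case True
  let ?U = "fold_map ` X_int p"
  define s where "s = 2 - 2 / p"
  define c where "c = 3 powr (- p) * (1 / (2 * (Lip + 1))) powr s"
  show ?thesis
  proof (rule that[of c 1])
    show "0 < c" using Lip_pos by (simp add: c_def)
    fix d :: real assume d: "0 < d" "d < 1"
    \<comment> \<open>The factor 2 makes \<open>(Lip + 1) * b\<close> strictly smaller than
      \<open>d\<close>.\<close>
    define b where "b = (1 / (2 * (Lip + 1))) * d"
    have b: "0 < b" "b < 1" "(Lip + 1) * b < d"
      using d Lip_pos by (auto simp: b_def field_simps intro: add_pos_pos)
    let ?A = "{q \<in> X_int p. infdist (fold_map q) (frontier ?U) < d}"
    have sub: "{q \<in> X_int p. r (fst q) < b} \<subseteq> ?A"
    proof
      fix q assume thin: "q \<in> {q \<in> X_int p. r (fst q) < b}"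
      obtain z w where zw: "q = (z, w)" by (cases q)
      have q: "(z, w) \<in> X_int p" "r z < b" using thin by (simp_all add: zw)
      \<comment> \<open>With this slack the exit distance is governed by \<open>b - norm w\<close>,
        hence by \<open>b\<close> wherever the point lies in its fibre.\<close>
      define \<delta> where "\<delta> = b - r z"
      have "\<delta> > 0" using q by (simp add: \<delta>_def)
      then obtain Q where Q: "Q \<in> fold_map ` outer" "dist (fold_map (z, w)) Q \<le> (Lip + 1) * (r z - norm w + \<delta>)"
        using exit_point[OF q(1)] by blast
      have "infdist (fold_map (z, w)) (frontier ?U) \<le> dist (fold_map (z, w)) Q"
        using q(1) Q(1) outer_disjoint by (intro infdist_frontier_le_dist) auto
      also have "\<dots> \<le> (Lip + 1) * (r z - norm w + \<delta>)" by (rule Q(2))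
      also have "\<dots> \<le> (Lip + 1) * b" using Lip_pos by (intro mult_left_mono) (auto simp: \<delta>_def)
      finally show "q \<in> ?A" using q(1) b(3) by (simp add: zw)
    qed
    have fin: "emeasure lborel ?A < \<infinity>"
      by (rule le_less_trans[OF emeasure_mono emeasure_X_int_finite[OF p]]) (auto simp: open_X_int)
    have "c * d powr s = 3 powr (- p) * b powr (2 - 2 / p)"
      using d Lip_pos unfolding c_def b_def s_def by (subst powr_mult) (simp_all only: mult.assoc)
    then have "ennreal (c * d powr s) \<le> emeasure lborel {q \<in> X_int p. r (fst q) < b}"
      using emeasure_thin_part[OF p b(1,2)] by simp
    also have "\<dots> \<le> emeasure lborel ?A"
      by (rule emeasure_mono[OF sub]) (simp add: open_collar_preimage)
    also have "\<dots> = ennreal (inner_collar_volume ?U d)"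
      unfolding inner_collar_volume_image using fin by (simp add: emeasure_eq_ennreal_measure)
    finally show "c * d powr (min 1 (2 - 2 / p)) \<le> inner_collar_volume ?U d"
      using True by (simp add: s_def inner_collar_volume_def min_def)
  qed simp
qed

lemma dim_image: "inner_minkowski_dim (fold_map ` X_int p) = ereal (4 - min 1 (2 - 2 / p))"
proof -
  obtain c d0 where "0 < c" "0 < d0" "\<And>d. 0 < d \<Longrightarrow> d < d0 \<Longrightarrow>
    c * d powr (min 1 (2 - 2 / p)) \<le> inner_collar_volume (fold_map ` X_int p) d"
    using collar_lower by blast
  moreover have "0 < min 1 (2 - 2 / p)" using p by (simp add: field_simps)
  ultimately show ?thesis
    by (intro inner_minkowski_dim_eqI[where c=c and ?d0.0=d0] collar_upper)
qed

lemma symplectic_copy: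
  "\<exists>K. compact K \<and> symplectomorphic (interior (X p)) (interior K) \<and>
       boundary_inner_minkowski_dim K = ereal (max (2 + 2 / p) 3)"
proof (intro exI conjI)
  let ?U = "fold_map ` X_int p"
  show "compact (closure ?U)" using bounded_image by (simp add: compact_closure)
  have "symplectomorphism (X_int p) ?U fold_map"
    using symplectic_on_subset[OF symplectic_fold_map X_int_subset_tube] unfolding symplectic_on_def
    by (intro symplectomorphism_of_injective open_X_int inj_on_subset[OF inj_on_fold_map X_int_subset_tube]) auto
  then show "symplectomorphic (interior (X p)) (interior (closure ?U))"
    unfolding symplectomorphic_def interior_X interior_closure_image by blast
  have "4 - min 1 (2 - 2 / p) = max (2 + 2 / p) 3" by (simp add: min_def max_def)
  then show "boundary_inner_minkowski_dim (closure ?U) = ereal (max (2 + 2 / p) 3)"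
    unfolding boundary_inner_minkowski_dim_def interior_closure_image dim_image by simp
qed

end

theorem proposition1p3:
  fixes p :: real
  assumes "p > 1"
  shows "\<exists>K. compact K \<and>
             symplectomorphic (interior (X p)) (interior K) \<and>
             boundary_inner_minkowski_dim K = ereal (max (2 + 2 / p) 3)"
proof -
  \<comment> \<open>With \<open>\<kappa> = 1 / 2 + \<eta>\<close> the exponent condition is
    \<open>1 + 3 * \<eta> + 2 * (\<eta> * \<eta>) \<le> p\<close>. Because
    \<open>\<eta> \<le> 1\<close> it follows from \<open>1 + 5 * \<eta> \<le> p\<close>, and the cap
    at 1/2 gives \<open>\<kappa> \<le> 1\<close>.\<close>
  define \<eta> where "\<eta> = min (1 / 2) ((p - 1) / 5)"
  define \<kappa> where "\<kappa> = 1 / 2 + \<eta>"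
  have \<eta>: "0 < \<eta>" "\<eta> \<le> 1 / 2" "5 * \<eta> \<le> p - 1"
    using assms by (auto simp: \<eta>_def min_def)
  have \<kappa>: "1 / 2 < \<kappa>" "\<kappa> \<le> 1" using \<eta> by (auto simp: \<kappa>_def)
  have "\<kappa> * (1 + 2 * \<kappa>) = 1 + 3 * \<eta> + 2 * (\<eta> * \<eta>)" by (simp add: \<kappa>_def algebra_simps)
  also have "\<dots> \<le> 1 + 3 * \<eta> + 2 * (\<eta> * 1)" using \<eta> by (intro add_left_mono mult_left_mono) auto
  finally have \<kappa>_p: "\<kappa> * (1 + 2 * \<kappa>) \<le> p" using \<eta> by linarith
  have cont: "continuous_on UNIV (decay \<kappa>)" by (rule smooth_on_imp_continuous_on[OF smooth_on_decay])
  obtain \<Theta> where \<Theta>: "\<forall>t. (\<Theta> has_real_derivative decay \<kappa> t) (at t)"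
    using antiderivative_exists[OF cont] by blast
  obtain g where g: "\<forall>t. (g has_real_derivative (decay \<kappa> t)\<^sup>2) (at t)"
    using antiderivative_exists[of "\<lambda>t. (decay \<kappa> t)\<^sup>2"] cont by (blast intro: continuous_on_power)
  then obtain M where M: "\<And>t. \<bar>g t\<bar> \<le> M"
    using bounded_antiderivative[OF \<kappa>(1), of g] by metis
  interpret folding_X \<kappa> g \<Theta> M p
    by unfold_locales (use \<kappa> g \<Theta> M assms \<kappa>_p in auto)
  show ?thesis by (rule symplectic_copy)
qed


end
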